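(* Let $n\ge 1$ be an integer, let $f:\mathbb{D}^{n}\to\mathbb{D}$ be a pluriharmonic mapping, and let $\alpha=(\alpha_{1},\ldots,\alpha_{n})$ be a multi-index of integers with $\alpha_{j}>0$ for every $j\in\{1,\ldots,n\}$. Then for every $z\in\mathbb{D}^{n}$, $$\left|\frac{\partial^{|\alpha|} f(z)}{\partial z_{1}^{\alpha_{1}}\cdots\partial z_{n}^{\alpha_{n}}}\right|+\left|\frac{\partial^{|\alpha|} f(z)}{\partial \overline{z}_{1}^{\alpha_{1}}\cdots\partial \overline{z}_{n}^{\alpha_{n}}}\right|\leq \alpha!\,\frac{4}{\pi}\,\frac{(1+\|z\|_{\infty})^{|\alpha|-n}}{(1-\|z\|_{\infty}^{2})^{|\alpha|}}.$$
   Context: $\mathbb{D}=\{\zeta\in\mathbb{C}:|\zeta|<1\}$ is the open unit disk and $\mathbb{D}^{n}=\mathbb{D}\times\cdots\times\mathbb{D}$ ($n$ times) is the unit polydisk in $\mathbb{C}^{n}$. For $z=(z_1,\ldots,z_n)\in\mathbb{C}^n$, $\|z\|_{\infty}=\max_{1\le j\le n}|z_{j}|$ and $\|z\|=(\sum_{j=1}^n|z_j|^2)^{1/2}$. For a multi-index $\alpha$, $|\alpha|=\sum_{j=1}^{n}\alpha_{j}$ and $\alpha!=\prod_{j=1}^n\alpha_j!$. The operators $\partial/\partial z_j$ and $\partial/\partial\overline{z}_j$ are the Wirtinger derivatives. A continuous complex-valued function $f$ on a domain $\Omega\subset\mathbb{C}^{n}$ is pluriharmonic if for each fixed $z\in\Omega$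 and each $\theta\in\mathbb{C}^n$ with $\|\theta\|=1$, the function $\zeta\mapsto f(z+\theta\zeta)$ is harmonic in $\{\zeta\in\mathbb{C}:|\zeta|<d_{\Omega}(z)\}$, where $d_{\Omega}(z)$ is the (Euclidean) distance from $z$ to $\partial\Omega$. On a simply connected domain $\Omega$ this is equivalent to $f=h+\overline{g}$ with $h,g$ holomorphic in $\Omega$. *)

theory Defs
  imports "HOL-Complex_Analysis.Complex_Analysis"
begin

(* Real directional derivative. Only meaningful where the difference quotient converges;
   at an interior point of a set it depends on the values of F on that set only. *)
definition dir_deriv ::
  "'a::real_normed_vector \<Rightarrow> ('a \<Rightarrow> 'b::real_normed_vector) \<Rightarrow> 'a \<Rightarrow> 'b" where
  "dir_deriv v F x = vector_derivative (\<lambda>t::real. F (x + t *\<^sub>R v)) (at 0)"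

definition C1_on :: "('a::euclidean_space \<Rightarrow> 'b::real_normed_vector) \<Rightarrow> 'a set \<Rightarrow> bool" where
  "C1_on F S \<longleftrightarrow>
     (\<forall>b\<in>Basis. (\<forall>x\<in>S. (\<lambda>t::real. F (x + t *\<^sub>R b)) differentiable (at 0)) \<and>
                continuous_on S (dir_deriv b F))"

definition C2_on :: "('a::euclidean_space \<Rightarrow> 'b::real_normed_vector) \<Rightarrow> 'a set \<Rightarrow> bool" where
  "C2_on F S \<longleftrightarrow> C1_on F S \<and> (\<forall>b\<in>Basis. C1_on (dir_deriv b F) S)"

definition laplacian :: "('a::euclidean_space \<Rightarrow> 'b::real_normed_vector) \<Rightarrow> 'a \<Rightarrow> 'b" where
  "laplacian F x = (\<Sum>b\<in>Basis. dir_deriv b (dir_deriv b F) x)"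

(* Used for open S. *)
definition harmonic_on :: "('a::euclidean_space \<Rightarrow> 'b::real_normed_vector) \<Rightarrow> 'a set \<Rightarrow> bool" where
  "harmonic_on F S \<longleftrightarrow> C2_on F S \<and> (\<forall>x\<in>S. laplacian F x = 0)"

(* Distance to the boundary; ereal-valued so that it is infinite when the boundary is empty,
   whereas infdist and setdist would give 0. *)
definition boundary_dist :: "'a::metric_space set \<Rightarrow> 'a \<Rightarrow> ereal" where
  "boundary_dist \<Omega> z = (INF w\<in>frontier \<Omega>. ereal (dist z w))"

(* Used for domains \<Omega>. The library norm on complex ^ 'n is the Euclidean one. *)
definition pluriharmonic_on :: "(complex ^ 'n::finite \<Rightarrow> complex) \<Rightarrow> (complex ^ 'n) set \<Rightarrow> bool" where
  "pluriharmonic_on f \<Omega> \<longleftrightarrow>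
     continuous_on \<Omega> f \<and>
     (\<forall>z\<in>\<Omega>. \<forall>\<theta>. norm \<theta> = 1 \<longrightarrow>
        harmonic_on (\<lambda>\<zeta>. f (z + \<zeta> *s \<theta>)) {\<zeta>. ereal (cmod \<zeta>) < boundary_dist \<Omega> z})"

definition polydisk :: "(complex ^ 'n::finite) set" where
  "polydisk = {z. \<forall>j. z $ j \<in> ball 0 1}"

(* The library's infnorm on complex ^ 'n is different: it is the maximum of the absolute values
   of all real and imaginary parts. *)
definition norm_max :: "complex ^ 'n::finite \<Rightarrow> real" where
  "norm_max z = Max (range (\<lambda>j. cmod (z $ j)))"

definition wirtinger :: "'n \<Rightarrow> (complex ^ 'n::finite \<Rightarrow> complex) \<Rightarrow> complex ^ 'n \<Rightarrow> complex" where
  "wirtinger j F z = (dir_deriv (axis j 1) F z - \<i> * dir_deriv (axis j \<i>) F z) / 2"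

definition wirtinger_bar :: "'n \<Rightarrow> (complex ^ 'n::finite \<Rightarrow> complex) \<Rightarrow> complex ^ 'n \<Rightarrow> complex" where
  "wirtinger_bar j F z = (dir_deriv (axis j 1) F z + \<i> * dir_deriv (axis j \<i>) F z) / 2"

(* For D = wirtinger and indices j1 < ... < jn this is (D j1 ^^ \<alpha> j1) (... ((D jn ^^ \<alpha> jn) F)).
   The linear order on the index type only serves to fix the order of differentiation. *)
definition iter_partial ::
  "('n::{finite,linorder} \<Rightarrow> ('f \<Rightarrow> 'f)) \<Rightarrow> ('n \<Rightarrow> nat) \<Rightarrow> 'f \<Rightarrow> 'f" where
  "iter_partial D \<alpha> F = foldr (\<lambda>j. D j ^^ \<alpha> j) (sorted_list_of_set UNIV) F"

end

theory Submission
  imports Defs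
begin

text \<open>
Write D for the composition of the holomorphic derivatives and f* for the conjugate of f. The
antiholomorphic derivative of f is the conjugate of D f*. Choosing a unimodular c that aligns the two
numbers, the left hand side of the theorem becomes |D u| with u = c f + cnj c f* = 2 Re (c f). The
function u is real, bounded by 2 and harmonic in each variable separately. So it is enough to bound
one mixed derivative of such a function, by M 2 / pi times a product of factors, one for each
variable, if |u| \<le> M.

In one variable let f = H + cnj K be harmonic on the unit disc. The Fourier coefficients of f with
positive index are the Taylor coefficients of H, so |H^(m)(0)| \<le> m! C, where C is a bound for the
Fourier coefficients of functions with the same range: C = M if |f| \<le> M, and C = 2 M / pi if f is
moreover real, because the mean of |cos| is 2 / pi. Composing with a disc automorphism and using
Bol's lemma (\<open>Bol_Moebius\<close>), this is carried from the centre to an arbitrary point z: for a > 0,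
|H^(a)(z)| \<le> C a! (1 + |z|)^(a-1) / (1 - |z|^2)^a, see \<open>coeff_bound_derivative_unit_disc\<close>.

For several variables the derivatives are taken one variable at a time. Since every order is
positive, a block of derivatives in the variable j selects the holomorphic part of the slice in that
direction (\<open>wirtinger_power_slice\<close>), and the result is again continuous and harmonic in the
remaining variables (\<open>sep_harmonic_wirtinger_power\<close>). The first block acts on a real function and
yields the factor 2 / pi; the others act on complex functions and multiply the bound by their own
factor only (\<open>deriv_list_bound\<close>). With M = 2 this gives the constant 4 / pi. Finally each factor is
monotone in |z_j|, which allows every |z_j| to be replaced by the maximum.

The analytic input is Poisson's formula on coordinate discs (\<open>harmonic_imp_poisson\<close>), which follows
from the maximum principle and the density of harmonic polynomials on the circle.
\<close>

section \<open>Circle means and Cauchy's formulas\<close>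

definition circle_mean :: "(complex \<Rightarrow> complex) \<Rightarrow> complex \<Rightarrow> real \<Rightarrow> complex" where
  "circle_mean f x r = integral {0..1} (\<lambda>t. f (x + r * cis (2 * pi * t)))"

lemma circle_point_in_sphere: "r \<ge> 0 \<Longrightarrow> x + complex_of_real r * cis t \<in> sphere x r"
  by (simp add: dist_norm norm_mult)

lemma circle_mean_integrable:
  fixes f :: "complex \<Rightarrow> complex"
  assumes "continuous_on (sphere x r) f" "r \<ge> 0"
  shows "(\<lambda>t. f (x + r * cis (2 * pi * t))) integrable_on {0..1}"
proof (rule integrable_continuous_real)
  show "continuous_on {0..1} (\<lambda>t. f (x + r * cis (2 * pi * t)))"
    by (rule continuous_on_compose2[OF assms(1)])
       (use assms(2) in \<open>auto intro!: continuous_intros circle_point_in_sphere\<close>)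
qed

lemma circle_mean_cong:
  assumes "r \<ge> 0" "\<And>w. w \<in> sphere x r \<Longrightarrow> f w = g w"
  shows "circle_mean f x r = circle_mean g x r"
  unfolding circle_mean_def using assms circle_point_in_sphere by (intro integral_cong) auto

lemma circle_mean_add:
  assumes "continuous_on (sphere x r) f" "continuous_on (sphere x r) g" "r \<ge> 0"
  shows "circle_mean (\<lambda>w. f w + g w) x r = circle_mean f x r + circle_mean g x r"
  unfolding circle_mean_def using assms by (intro integral_add circle_mean_integrable)

lemma circle_mean_diff:
  assumes "continuous_on (sphere x r) f" "continuous_on (sphere x r) g" "r \<ge> 0"
  shows "circle_mean (\<lambda>w. f w - g w) x r = circle_mean f x r - circle_mean g x r"
  unfolding circle_mean_def using assms by (intro integral_diff circle_mean_integrable)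

lemma circle_mean_cmult: "circle_mean (\<lambda>w. c * f w) x r = c * circle_mean f x r"
  unfolding circle_mean_def by (rule integral_mult_right)

lemma circle_mean_cnj: "circle_mean (\<lambda>w. cnj (f w)) x r = cnj (circle_mean f x r)"
  unfolding circle_mean_def by (simp add: integral_cnj)

lemma circle_mean_norm_le:
  assumes "continuous_on (sphere x r) f" "r \<ge> 0" "\<And>w. w \<in> sphere x r \<Longrightarrow> cmod (f w) \<le> B"
  shows "cmod (circle_mean f x r) \<le> B"
proof -
  have "cmod (circle_mean f x r) \<le> integral {0..1} (\<lambda>t::real. B)"
    unfolding circle_mean_def
    by (rule integral_norm_bound_integral)
       (use assms circle_mean_integrable circle_point_in_sphere in auto)
  then show ?thesis by simp
qed

text \<open>With w = x + r cis(2 pi t) one has dw / (w - x) = 2 pi i dt. This is the bridge from circle means to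
the contour integrals in which Cauchy's theorems are phrased.\<close>
lemma circle_mean_has_contour_integral:
  assumes "continuous_on (sphere x r) f" "r > 0"
  shows "((\<lambda>w. f w / (w - x)) has_contour_integral (2 * pi * \<i>) * circle_mean f x r) (circlepath x r)"
proof -
  have "((\<lambda>t. f (x + r * cis (2 * pi * t))) has_integral circle_mean f x r) {0..1}"
    unfolding circle_mean_def using circle_mean_integrable[OF assms(1)] assms(2)
    by (simp add: integrable_integral)
  from has_integral_mult_right[OF this, of "2 * pi * \<i>"]
  have "((\<lambda>t. (2 * pi * \<i>) * f (x + r * cis (2 * pi * t))) has_integral
         (2 * pi * \<i>) * circle_mean f x r) {0..1}" .
  then show ?thesis
    unfolding has_contour_integral_def
  proof (rule has_integral_eq[rotated])
    fix t :: real assume "t \<in> {0..1}"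
    then have "vector_derivative (circlepath x r) (at t within {0..1}) =
        2 * pi * \<i> * r * cis (2 * pi * t)"
      using vector_derivative_circlepath01[of t x r] by (simp add: cis_conv_exp mult_ac)
    moreover have "circlepath x r t = x + r * cis (2 * pi * t)"
      by (simp add: circlepath cis_conv_exp mult_ac)
    ultimately show "2 * pi * \<i> * f (x + r * cis (2 * pi * t)) =
        f (circlepath x r t) / (circlepath x r t - x) * vector_derivative (circlepath x r) (at t within {0..1})"
      using assms(2) by simp
  qed
qed

text \<open>Cauchy's formula for derivatives; the factor w - x converts dw into the normalized angle, by
\<open>circle_mean_has_contour_integral\<close>.\<close>
lemma Cauchy_circle_mean:
  assumes "continuous_on (cball x r) f" "f holomorphic_on ball x r" "a \<in> ball x r"
  shows "circle_mean (\<lambda>w. f w * ((w - x) / (w - a) ^ Suc k)) x r = (deriv ^^ k) f a / fact k"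
proof -
  have r: "r > 0" using assms(3) by (metis ball_empty empty_iff not_le)
  have ne: "w \<noteq> a" if "w \<in> sphere x r" for w using that assms(3) by auto
  have "((\<lambda>u. f u / (u - a) ^ Suc k) has_contour_integral ((2 * pi * \<i>) / fact k * (deriv ^^ k) f a))
           (circlepath x r)"
    by (rule Cauchy_has_contour_integral_higher_derivative_circlepath[OF assms])
  moreover have "((\<lambda>w. f w * ((w - x) / (w - a) ^ Suc k) / (w - x)) has_contour_integral
      (2 * pi * \<i>) * circle_mean (\<lambda>w. f w * ((w - x) / (w - a) ^ Suc k)) x r) (circlepath x r)"
    by (rule circle_mean_has_contour_integral[OF _ r])
       (use ne assms in \<open>auto intro!: continuous_intros intro: continuous_on_subset\<close>)
  then have "((\<lambda>u. f u / (u - a) ^ Suc k) has_contour_integral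
      (2 * pi * \<i>) * circle_mean (\<lambda>w. f w * ((w - x) / (w - a) ^ Suc k)) x r) (circlepath x r)"
  proof (rule has_contour_integral_eq)
    fix w :: complex assume "w \<in> path_image (circlepath x r)"
    then have "w \<noteq> x" using r by (auto simp: path_image_circlepath)
    then show "f w * ((w - x) / (w - a) ^ Suc k) / (w - x) = f w / (w - a) ^ Suc k" by simp
  qed
  ultimately have "(2 * pi * \<i>) / fact k * (deriv ^^ k) f a =
      (2 * pi * \<i>) * circle_mean (\<lambda>w. f w * ((w - x) / (w - a) ^ Suc k)) x r"
    by (rule has_contour_integral_unique)
  then show ?thesis by (simp add: field_simps)
qed

lemma circle_mean_taylor_coeff:
  assumes "continuous_on (cball x r) f" "f holomorphic_on ball x r" "r > 0"
  shows "circle_mean (\<lambda>w. f w / (w - x) ^ k) x r = (deriv ^^ k) f x / fact k"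
proof -
  have "circle_mean (\<lambda>w. f w / (w - x) ^ k) x r = circle_mean (\<lambda>w. f w * ((w - x) / (w - x) ^ Suc k)) x r"
    by (rule circle_mean_cong) (use assms(3) in auto)
  then show ?thesis using Cauchy_circle_mean[OF assms(1,2), of x k] assms(3) by simp
qed

lemma circle_mean_holomorphic:
  assumes "continuous_on (cball x r) f" "f holomorphic_on ball x r" "r > 0"
  shows "circle_mean f x r = f x"
  using circle_mean_taylor_coeff[OF assms, of 0] by simp

text \<open>On the circle, (w - x)^(-k) is a constant multiple of the conjugate of (w - x)^k, so the mean is the
conjugate of a mean of a holomorphic function that vanishes at the centre.\<close>
lemma circle_mean_antiholomorphic_coeff:
  assumes "continuous_on (cball x r) f" "f holomorphic_on ball x r" "r > 0" "k > 0"
  shows "circle_mean (\<lambda>w. cnj (f w) / (w - x) ^ k) x r = 0"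
proof -
  have "circle_mean (\<lambda>w. cnj (f w) / (w - x) ^ k) x r =
     circle_mean (\<lambda>w. cnj (f w * (w - x) ^ k / r ^ (2 * k))) x r"
  proof (rule circle_mean_cong)
    fix w :: complex assume w: "w \<in> sphere x r"
    then have "cmod (w - x) = r" by (simp add: dist_norm norm_minus_commute)
    then have *: "(w - x) * cnj (w - x) = of_real r ^ 2"
      by (metis complex_norm_square of_real_power)
    have ne: "w \<noteq> x" using w assms(3) by auto
    have "cnj (w - x) ^ k * (w - x) ^ k = of_real r ^ (2 * k)"
      using * by (metis mult.commute power_mult power_mult_distrib)
    then show "cnj (f w) / (w - x) ^ k = cnj (f w * (w - x) ^ k / r ^ (2 * k))"
      using ne assms(3) by (simp add: field_simps)
  qed (use assms in auto)
  also have "\<dots> = cnj (circle_mean (\<lambda>w. f w * (w - x) ^ k / r ^ (2 * k)) x r)"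
    by (rule circle_mean_cnj)
  also have "circle_mean (\<lambda>w. f w * (w - x) ^ k / r ^ (2 * k)) x r = 0"
    by (subst circle_mean_holomorphic)
       (use assms in \<open>auto intro!: continuous_intros holomorphic_intros\<close>)
  finally show ?thesis by simp
qed

section \<open>Poisson integrals\<close>

text \<open>On the circle |w| = r this is the Poisson kernel (r^2 - |z|^2) / |w - z|^2. Written as the Cauchy
kernel plus its conjugate it makes the splitting of a Poisson integral into a holomorphic and an
antiholomorphic part visible; complex values avoid coercions under the mean.\<close>
definition poisson_kernel :: "complex \<Rightarrow> complex \<Rightarrow> complex" where
  "poisson_kernel w z = w / (w - z) + cnj (w / (w - z)) - 1"

lemma cnj_poisson_kernel: "cnj (poisson_kernel w z) = poisson_kernel w z"
  by (simp add: poisson_kernel_def)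

lemma continuous_on_poisson_kernel:
  assumes "z \<notin> S"
  shows "continuous_on S (\<lambda>w. poisson_kernel w z)"
  unfolding poisson_kernel_def using assms by (auto intro!: continuous_intros)

text \<open>On |w| = r the conjugated half of the kernel equals r^2 / (r^2 - w cnj z), which is holomorphic in w
on the whole disc. Hence that half contributes f 0, the term -1 removes f 0 again, and the Cauchy
kernel gives f z.\<close>
lemma poisson_holomorphic:
  assumes "continuous_on (cball 0 r) f" "f holomorphic_on ball 0 r" "z \<in> ball 0 r"
  shows "circle_mean (\<lambda>w. f w * poisson_kernel w z) 0 r = f z"
proof -
  have r: "r > 0" using assms(3) by (metis ball_empty empty_iff not_le)
  have ne: "w \<noteq> z" if "w \<in> sphere 0 r" for w using that assms(3) by auto
  have ne2: "r^2 - cnj z * w \<noteq> 0" if "w \<in> cball 0 r" for w :: complex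
  proof
    assume "r^2 - cnj z * w = 0"
    then have "complex_of_real (r^2) = cnj z * w" by simp
    then have "cmod z * cmod w = r^2" by (metis abs_power2 complex_mod_cnj norm_mult norm_of_real)
    moreover have "cmod z * cmod w \<le> cmod z * r" using that by (intro mult_left_mono) auto
    moreover have "cmod z * r < r * r" using assms(3) r by auto
    ultimately show False by (simp add: power2_eq_square)
  qed
  have cs: "continuous_on (sphere 0 r) f" using assms(1) by (rule continuous_on_subset) auto
  define A where "A w = f w * (w / (w - z))" for w
  define B where "B w = f w * (r^2 / (r^2 - cnj z * w))" for w
  have cA: "continuous_on (sphere 0 r) A" unfolding A_def using ne
    by (auto intro!: continuous_intros cs)
  have cB: "continuous_on (cball 0 r) B" unfolding B_def using ne2 
    by (auto intro!: continuous_intros assms(1))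
  have hB: "B holomorphic_on ball 0 r" unfolding B_def using ne2 
    by (auto intro!: holomorphic_intros assms(2))
  have "circle_mean (\<lambda>w. f w * poisson_kernel w z) 0 r = circle_mean (\<lambda>w. A w + (B w - f w)) 0 r"
  proof (rule circle_mean_cong)
    fix w :: complex assume w: "w \<in> sphere 0 r"
    then have "cmod w = r" by simp
    then have *: "w * cnj w = of_real r ^ 2"
      by (metis complex_norm_square of_real_power)
    have "cnj w / (cnj w - cnj z) = (w * cnj w) / (w * cnj w - cnj z * w)"
    proof -
      have "w \<noteq> 0" using w r by auto
      then have "cnj w / (cnj w - cnj z) = (w * cnj w) / (w * (cnj w - cnj z))" by simp
      then show ?thesis by (simp add: algebra_simps)
    qed
    also have "\<dots> = r^2 / (r^2 - cnj z * w)" by (simp add: *)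
    finally show "f w * poisson_kernel w z = A w + (B w - f w)"
      by (simp add: A_def B_def poisson_kernel_def algebra_simps)
  qed (use r in auto)
  also have "\<dots> = circle_mean A 0 r + (circle_mean B 0 r - circle_mean f 0 r)"
  proof -
    have "continuous_on (sphere 0 r) B" using cB by (rule continuous_on_subset) auto
    then show ?thesis using cA cs r
      by (subst circle_mean_add circle_mean_diff; auto intro!: continuous_intros)+
  qed
  also have "circle_mean A 0 r = f z"
    using Cauchy_circle_mean[OF assms(1,2,3), of 0] by (simp add: A_def[abs_def])
  also have "circle_mean B 0 r = B 0" using circle_mean_holomorphic[OF cB hB r] .
  also have "circle_mean f 0 r = f 0" using circle_mean_holomorphic[OF assms(1,2) r] .
  finally show ?thesis using r by (simp add: B_def)
qed

lemma holomorphic_Cauchy_transform: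
  assumes "continuous_on (sphere 0 r) f"
  shows "(\<lambda>z. circle_mean (\<lambda>w. f w * (w / (w - z))) 0 r) holomorphic_on ball 0 r"
proof (cases "r > 0")
  case r: True
  define g where "g z = (2 * pi * \<i>) * circle_mean (\<lambda>w. f w * (w / (w - z))) 0 r" for z
  have "((\<lambda>u. f u / (u - z) ^ 1) has_contour_integral g z) (circlepath 0 r)" if "z \<in> ball 0 r" for z
  proof -
    have ne: "w \<noteq> z" if "w \<in> sphere 0 r" for w using that \<open>z \<in> ball 0 r\<close> by auto
    have "((\<lambda>w. f w * (w / (w - z)) / (w - 0)) has_contour_integral g z) (circlepath 0 r)"
      unfolding g_def by (rule circle_mean_has_contour_integral[OF _ r])
       (use ne assms in \<open>auto intro!: continuous_intros\<close>)
    then show ?thesis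
      by (rule has_contour_integral_eq) (use r in \<open>auto simp: path_image_circlepath\<close>)
  qed
  then have "g field_differentiable (at z)" if "z \<in> ball 0 r" for z
    using Cauchy_next_derivative_circlepath(2)[of 0 r f 1 g z] that assms r
    unfolding field_differentiable_def by auto
  then have "g holomorphic_on ball 0 r"
    by (auto simp: holomorphic_on_def intro: field_differentiable_at_within)
  then have "(\<lambda>z. g z / (2 * pi * \<i>)) holomorphic_on ball 0 r"
    by (auto intro!: holomorphic_intros)
  then show ?thesis by (simp add: g_def)
next
  case False
  then show ?thesis by (simp add: ball_empty holomorphic_on_def)
qed

text \<open>The converse direction: the two halves of the kernel give Cauchy transforms of f and of its
conjugate, and these are holomorphic in z. The mean of f, subtracted by the kernel, is a constant
and is put into the antiholomorphic part.\<close>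
lemma poisson_imp_harmonic_decomposition:
  assumes cont: "continuous_on (sphere 0 r) f"
    and f: "\<And>z. z \<in> ball 0 r \<Longrightarrow> f z = circle_mean (\<lambda>w. f w * poisson_kernel w z) 0 r"
  obtains H K where "H holomorphic_on ball 0 r" "K holomorphic_on ball 0 r"
    "\<And>z. z \<in> ball 0 r \<Longrightarrow> f z = H z + cnj (K z)"
proof (cases "r > 0")
  case r: True
  define H where "H z = circle_mean (\<lambda>w. f w * (w / (w - z))) 0 r" for z
  define K where "K z = circle_mean (\<lambda>w. cnj (f w) * (w / (w - z))) 0 r - cnj (circle_mean f 0 r)" for z
  show ?thesis
  proof (rule that[of H K])
    show "H holomorphic_on ball 0 r" unfolding H_def by (rule holomorphic_Cauchy_transform[OF cont])
    have "continuous_on (sphere 0 r) (\<lambda>w. cnj (f w))" by (intro continuous_intros cont)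
    then show "K holomorphic_on ball 0 r" unfolding K_def
      by (intro holomorphic_intros holomorphic_Cauchy_transform)
    fix z :: complex assume z: "z \<in> ball 0 r"
    then have ne: "w \<noteq> z" if "w \<in> sphere 0 r" for w using that by auto
    have "f z = circle_mean (\<lambda>w. f w * (w / (w - z)) + (cnj (cnj (f w) * (w / (w - z))) - f w)) 0 r"
      unfolding f[OF z] poisson_kernel_def by (simp add: algebra_simps)
    also have "\<dots> = H z + cnj (K z)"
      unfolding H_def K_def complex_cnj_diff complex_cnj_cnj circle_mean_cnj[symmetric]
      by (subst circle_mean_add circle_mean_diff; use ne cont r in \<open>auto intro!: continuous_intros\<close>)+
    finally show "f z = H z + cnj (K z)" .
  qed
next
  case False
  then show ?thesis using that[of "\<lambda>_. 0" "\<lambda>_. 0"] by (simp add: ball_empty)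
qed

text \<open>The Fourier coefficients of positive index of H + cnj K see the holomorphic part only. This expresses
a holomorphic derivative of a harmonic function by values of the function itself, with a kernel that
does not involve H or K.\<close>
lemma harmonic_coeff_formula:
  assumes H: "H holomorphic_on S" and K: "K holomorphic_on S"
    and f: "\<And>z. z \<in> S \<Longrightarrow> f z = H z + cnj (K z)"
    and S: "cball x \<rho> \<subseteq> S" "\<rho> > 0" and k: "k > 0"
  shows "circle_mean (\<lambda>w. f w / (w - x) ^ k) x \<rho> = (deriv ^^ k) H x / fact k"
proof -
  have cH: "continuous_on (cball x \<rho>) H" and cK: "continuous_on (cball x \<rho>) K"
    using H K S by (meson holomorphic_on_imp_continuous_on holomorphic_on_subset)+
  have "ball x \<rho> \<subseteq> S" using S by auto
  then have hH: "H holomorphic_on ball x \<rho>" and hK: "K holomorphic_on ball x \<rho>"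
    using H K holomorphic_on_subset by blast+
  have "sphere x \<rho> \<subseteq> cball x \<rho>" by auto
  then have cHs: "continuous_on (sphere x \<rho>) H" and cKs: "continuous_on (sphere x \<rho>) K"
    using cH cK continuous_on_subset by blast+
  have "circle_mean (\<lambda>w. f w / (w - x) ^ k) x \<rho> =
        circle_mean (\<lambda>w. H w / (w - x) ^ k + cnj (K w) / (w - x) ^ k) x \<rho>"
    using S by (intro circle_mean_cong) (auto simp: f subset_iff add_divide_distrib)
  also have "\<dots> = circle_mean (\<lambda>w. H w / (w - x) ^ k) x \<rho> + circle_mean (\<lambda>w. cnj (K w) / (w - x) ^ k) x \<rho>"
    using S by (intro circle_mean_add continuous_intros cHs cKs) auto
  finally show ?thesis
    using circle_mean_taylor_coeff[OF cH hH S(2)] circle_mean_antiholomorphic_coeff[OF cK hK S(2) k]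
    by simp
qed

section \<open>Trigonometric approximation on a circle\<close>

text \<open>Harmonic polynomials, presented by their monomials so that products can be treated by induction.\<close>
inductive harmonic_poly :: "(complex \<Rightarrow> complex) \<Rightarrow> bool" where
  power: "harmonic_poly (\<lambda>z. c * z ^ k)"
| cnj_power: "harmonic_poly (\<lambda>z. c * cnj z ^ k)"
| add: "harmonic_poly g \<Longrightarrow> harmonic_poly h \<Longrightarrow> harmonic_poly (\<lambda>z. g z + h z)"

lemma harmonic_poly_decomposition:
  assumes "harmonic_poly h"
  shows "\<exists>A B. A holomorphic_on UNIV \<and> B holomorphic_on UNIV \<and> h = (\<lambda>z. A z + cnj (B z))"
  using assms
proof induction
  case (power c k)
  show ?case by (intro exI[of _ "\<lambda>z. c * z ^ k"] exI[of _ "\<lambda>z. 0"]) (auto intro!: holomorphic_intros)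
next
  case (cnj_power c k)
  show ?case by (intro exI[of _ "\<lambda>z. cnj c * z ^ k"] exI[of _ "\<lambda>z. 0"]) (auto intro!: holomorphic_intros)
next
  case (add g h)
  then obtain A B A' B' where "A holomorphic_on UNIV" "B holomorphic_on UNIV" "g = (\<lambda>z. A z + cnj (B z))"
    "A' holomorphic_on UNIV" "B' holomorphic_on UNIV" "h = (\<lambda>z. A' z + cnj (B' z))" by blast
  then show ?case
    by (intro exI[of _ "\<lambda>z. A z + A' z"] exI[of _ "\<lambda>z. B z + B' z"]) (auto intro!: holomorphic_intros)
qed

text \<open>Restrictions of harmonic polynomials to the circle of radius r, that is, trigonometric polynomials.
In contrast to harmonic polynomials they form an algebra.\<close>
definition trig_on :: "real \<Rightarrow> (complex \<Rightarrow> complex) \<Rightarrow> bool" where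
  "trig_on r g \<longleftrightarrow> (\<exists>h. harmonic_poly h \<and> (\<forall>z\<in>sphere 0 r. g z = h z))"

lemma trig_on_cong: "trig_on r f \<Longrightarrow> (\<And>z. z \<in> sphere 0 r \<Longrightarrow> g z = f z) \<Longrightarrow> trig_on r g"
  unfolding trig_on_def by metis

lemma trig_on_harmonic_poly: "harmonic_poly h \<Longrightarrow> trig_on r h"
  unfolding trig_on_def by blast

lemma trig_on_add: "trig_on r f \<Longrightarrow> trig_on r g \<Longrightarrow> trig_on r (\<lambda>z. f z + g z)"
  unfolding trig_on_def by (metis harmonic_poly.add)

lemma trig_on_const: "trig_on r (\<lambda>_. c)"
  using trig_on_harmonic_poly[OF harmonic_poly.power[of c 0]] by simp

lemma sphere_mult_cnj: "z \<in> sphere 0 r \<Longrightarrow> z * cnj z = of_real (r ^ 2)"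
  by (metis complex_norm_square mem_sphere_0)

text \<open>On the circle z * cnj z = r^2, so a mixed monomial reduces to a pure power of z or of cnj z.\<close>
lemma trig_on_monomial: "trig_on r (\<lambda>z. c * z ^ k * cnj z ^ l)"
proof (cases "k \<ge> l")
  case True
  have "trig_on r (\<lambda>z. (c * of_real (r ^ 2) ^ l) * z ^ (k - l))"
    by (intro trig_on_harmonic_poly harmonic_poly.power)
  then show ?thesis
  proof (rule trig_on_cong)
    fix z :: complex assume "z \<in> sphere 0 r"
    then have "of_real (r ^ 2) ^ l = z ^ l * cnj z ^ l"
      using sphere_mult_cnj by (metis power_mult_distrib)
    moreover have "z ^ k = z ^ (k - l) * z ^ l" using True by (simp flip: power_add)
    ultimately show "c * z ^ k * cnj z ^ l = (c * of_real (r ^ 2) ^ l) * z ^ (k - l)"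
      by (simp only: mult_ac)
  qed
next
  case False
  have "trig_on r (\<lambda>z. (c * of_real (r ^ 2) ^ k) * cnj z ^ (l - k))"
    by (intro trig_on_harmonic_poly harmonic_poly.cnj_power)
  then show ?thesis
  proof (rule trig_on_cong)
    fix z :: complex assume "z \<in> sphere 0 r"
    then have "of_real (r ^ 2) ^ k = z ^ k * cnj z ^ k"
      using sphere_mult_cnj by (metis power_mult_distrib)
    moreover have "cnj z ^ l = cnj z ^ (l - k) * cnj z ^ k" using False by (simp flip: power_add)
    ultimately show "c * z ^ k * cnj z ^ l = (c * of_real (r ^ 2) ^ k) * cnj z ^ (l - k)"
      by (simp only: mult_ac)
  qed
qed

lemma trig_on_monomial_mult:
  assumes "harmonic_poly h"
  shows "trig_on r (\<lambda>z. c * z ^ k * cnj z ^ l * h z)"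
  using assms
proof induction
  case (power d m)
  show ?case using trig_on_monomial[of r "c * d" "k + m" l] by (simp add: power_add mult_ac)
next
  case (cnj_power d m)
  show ?case using trig_on_monomial[of r "c * d" k "l + m"] by (simp add: power_add mult_ac)
next
  case (add g h)
  then show ?case using trig_on_add by (simp add: distrib_left)
qed

lemma trig_on_mult_poly:
  assumes "harmonic_poly g" "harmonic_poly h"
  shows "trig_on r (\<lambda>z. g z * h z)"
  using assms(1)
proof induction
  case (power c k)
  show ?case using trig_on_monomial_mult[OF assms(2), of r c k 0] by simp
next
  case (cnj_power c k)
  show ?case using trig_on_monomial_mult[OF assms(2), of r c 0 k] by simp
next
  case (add g1 g2)
  then show ?case using trig_on_add by (simp add: distrib_right)
qed

lemma trig_on_mult:
  assumes "trig_on r f" "trig_on r g"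
  shows "trig_on r (\<lambda>z. f z * g z)"
proof -
  obtain f' g' where "harmonic_poly f'" "\<forall>z\<in>sphere 0 r. f z = f' z"
     "harmonic_poly g'" "\<forall>z\<in>sphere 0 r. g z = g' z"
    using assms unfolding trig_on_def by blast
  then show ?thesis using trig_on_cong[OF trig_on_mult_poly[of f' g' r], of "\<lambda>z. f z * g z"] by simp
qed

lemma trig_on_coordinates:
  "trig_on r (\<lambda>z. of_real (Re z))" "trig_on r (\<lambda>z. of_real (Im z))"
proof -
  have "trig_on r (\<lambda>z. (1/2) * z ^ 1 + (1/2) * cnj z ^ 1)"
    by (intro trig_on_harmonic_poly harmonic_poly.intros)
  then show "trig_on r (\<lambda>z. of_real (Re z))"
    by (rule trig_on_cong) (simp add: complex_eq_iff)
  have "trig_on r (\<lambda>z. (-\<i>/2) * z ^ 1 + (\<i>/2) * cnj z ^ 1)"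
    by (intro trig_on_harmonic_poly harmonic_poly.intros)
  then show "trig_on r (\<lambda>z. of_real (Im z))"
    by (rule trig_on_cong) (simp add: complex_eq_iff)
qed

lemma trig_on_dense_real:
  assumes "continuous_on (sphere 0 r) g" "e > 0"
  shows "\<exists>p::complex \<Rightarrow> real. trig_on r (\<lambda>z. of_real (p z)) \<and> (\<forall>z\<in>sphere 0 r. \<bar>g z - p z\<bar> < e)"
proof -
  define P where "P p \<longleftrightarrow> continuous_on (sphere 0 r) p \<and> trig_on r (\<lambda>z. of_real (p z))"
    for p :: "complex \<Rightarrow> real"
  have "\<exists>p. P p \<and> (\<forall>z\<in>sphere 0 r. \<bar>g z - p z\<bar> < e)"
  proof (rule Stone_Weierstrass_HOL[of "sphere 0 r" P g e])
    fix x y :: complex assume "x \<in> sphere 0 r \<and> y \<in> sphere 0 r \<and> x \<noteq> y"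
    moreover have "P Re" "P Im" unfolding P_def using trig_on_coordinates
      by (auto intro!: continuous_intros)
    ultimately show "\<exists>f. P f \<and> f x \<noteq> f y" using complex_eq_iff[of x y] by blast
  qed (use assms trig_on_const trig_on_add trig_on_mult in \<open>auto simp: P_def intro!: continuous_intros\<close>)
  then show ?thesis unfolding P_def by blast
qed

text \<open>Weierstrass' trigonometric approximation theorem, obtained from the real Stone--Weierstrass theorem
for the real and imaginary parts.\<close>
lemma harmonic_poly_dense_on_sphere:
  assumes "continuous_on (sphere 0 r) f" "e > 0"
  obtains h where "harmonic_poly h" "\<And>z. z \<in> sphere 0 r \<Longrightarrow> cmod (f z - h z) \<le> e"
proof -
  obtain p where p: "trig_on r (\<lambda>z. of_real (p z))" "\<forall>z\<in>sphere 0 r. \<bar>Re (f z) - p z\<bar> < e / 2"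
    using trig_on_dense_real[of r "\<lambda>z. Re (f z)" "e/2"] assms by (auto intro!: continuous_intros)
  obtain q where q: "trig_on r (\<lambda>z. of_real (q z))" "\<forall>z\<in>sphere 0 r. \<bar>Im (f z) - q z\<bar> < e / 2"
    using trig_on_dense_real[of r "\<lambda>z. Im (f z)" "e/2"] assms by (auto intro!: continuous_intros)
  have "trig_on r (\<lambda>z. of_real (p z) + \<i> * of_real (q z))"
    by (intro trig_on_add trig_on_mult trig_on_const p q)
  then obtain h where h: "harmonic_poly h" "\<forall>z\<in>sphere 0 r. of_real (p z) + \<i> * of_real (q z) = h z"
    unfolding trig_on_def by blast
  show ?thesis
  proof (rule that[OF h(1)])
    fix z :: complex assume z: "z \<in> sphere 0 r"
    have "cmod (f z - h z) \<le> \<bar>Re (f z - h z)\<bar> + \<bar>Im (f z - h z)\<bar>" by (rule cmod_le)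
    also have "\<dots> = \<bar>Re (f z) - p z\<bar> + \<bar>Im (f z) - q z\<bar>" using z by (simp add: h(2)[rule_format, symmetric])
    also have "\<dots> \<le> e" using z p(2) q(2) by force
    finally show "cmod (f z - h z) \<le> e" .
  qed
qed

section \<open>The maximum principle and Poisson's formula\<close>

text \<open>Harmonicity at one point, by pure second derivatives along the two coordinate lines: p and q are the
first derivatives along these lines, a and -a the second ones. This is what the second derivative
test at a maximum consumes, and it can be transported from one disc to another point by point.\<close>
definition harmonic_at :: "(complex \<Rightarrow> 'b::real_normed_vector) \<Rightarrow> complex \<Rightarrow> bool" where
  "harmonic_at g x \<longleftrightarrow> (\<exists>p q a.
     (\<forall>\<^sub>F t in nhds 0. ((\<lambda>t. g (x + of_real t)) has_vector_derivative p t) (at t)) \<and>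
     (p has_vector_derivative a) (at 0) \<and>
     (\<forall>\<^sub>F t in nhds 0. ((\<lambda>t. g (x + of_real t * \<i>)) has_vector_derivative q t) (at t)) \<and>
     (q has_vector_derivative - a) (at 0))"

lemma harmonic_at_add:
  assumes "harmonic_at f x" "harmonic_at g x"
  shows "harmonic_at (\<lambda>z. f z + g z) x"
proof -
  from assms(1) obtain p q a where f:
     "\<forall>\<^sub>F t in nhds 0. ((\<lambda>t. f (x + of_real t)) has_vector_derivative p t) (at t)"
     "(p has_vector_derivative a) (at 0)"
     "\<forall>\<^sub>F t in nhds 0. ((\<lambda>t. f (x + of_real t * \<i>)) has_vector_derivative q t) (at t)"
     "(q has_vector_derivative - a) (at 0)" unfolding harmonic_at_def by blast
  from assms(2) obtain p' q' a' where g: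
     "\<forall>\<^sub>F t in nhds 0. ((\<lambda>t. g (x + of_real t)) has_vector_derivative p' t) (at t)"
     "(p' has_vector_derivative a') (at 0)"
     "\<forall>\<^sub>F t in nhds 0. ((\<lambda>t. g (x + of_real t * \<i>)) has_vector_derivative q' t) (at t)"
     "(q' has_vector_derivative - a') (at 0)" unfolding harmonic_at_def by blast
  show ?thesis
    unfolding harmonic_at_def
  proof (intro exI conjI)
    show "\<forall>\<^sub>F t in nhds 0. ((\<lambda>t. f (x + of_real t) + g (x + of_real t)) has_vector_derivative p t + p' t) (at t)"
      using f(1) g(1) by eventually_elim (rule has_vector_derivative_add)
    show "((\<lambda>t. p t + p' t) has_vector_derivative a + a') (at 0)"
      by (intro has_vector_derivative_add f g)
    show "\<forall>\<^sub>F t in nhds 0. ((\<lambda>t. f (x + of_real t * \<i>) + g (x + of_real t * \<i>)) has_vector_derivative q t + q' t) (at t)"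
      using f(3) g(3) by eventually_elim (rule has_vector_derivative_add)
    show "((\<lambda>t. q t + q' t) has_vector_derivative - (a + a')) (at 0)"
      using has_vector_derivative_add[OF f(4) g(4)] by simp
  qed
qed

lemma harmonic_at_bounded_linear:
  assumes "bounded_linear L" "harmonic_at f x"
  shows "harmonic_at (\<lambda>z. L (f z)) x"
proof -
  from assms(2) obtain p q a where f:
     "\<forall>\<^sub>F t in nhds 0. ((\<lambda>t. f (x + of_real t)) has_vector_derivative p t) (at t)"
     "(p has_vector_derivative a) (at 0)"
     "\<forall>\<^sub>F t in nhds 0. ((\<lambda>t. f (x + of_real t * \<i>)) has_vector_derivative q t) (at t)"
     "(q has_vector_derivative - a) (at 0)" unfolding harmonic_at_def by blast
  note L = bounded_linear.has_vector_derivative[OF assms(1)]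
  show ?thesis
    unfolding harmonic_at_def
  proof (intro exI conjI)
    show "\<forall>\<^sub>F t in nhds 0. ((\<lambda>t. L (f (x + of_real t))) has_vector_derivative L (p t)) (at t)"
      using f(1) by eventually_elim (rule L)
    show "((\<lambda>t. L (p t)) has_vector_derivative L a) (at 0)" by (rule L[OF f(2)])
    show "\<forall>\<^sub>F t in nhds 0. ((\<lambda>t. L (f (x + of_real t * \<i>))) has_vector_derivative L (q t)) (at t)"
      using f(3) by eventually_elim (rule L)
    show "((\<lambda>t. L (q t)) has_vector_derivative - L a) (at 0)"
      using L[OF f(4)] assms(1) by (simp add: linear_simps)
  qed
qed

lemma harmonic_at_holomorphic:
  assumes "A holomorphic_on UNIV"
  shows "harmonic_at A x"
proof -
  have d: "((\<lambda>t. A' (x + of_real t * b)) has_vector_derivative b * deriv A' (x + of_real t * b)) (at t)"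
    if "A' holomorphic_on UNIV" for A' b t
  proof -
    have "(A' has_field_derivative deriv A' (x + of_real t * b)) (at (x + of_real t * b))"
      using that by (simp add: holomorphic_derivI)
    moreover have "((\<lambda>t. x + of_real t * b) has_vector_derivative b) (at t)"
      by (auto intro!: derivative_eq_intros simp: has_vector_derivative_def scaleR_conv_of_real)
    ultimately show ?thesis
      using field_vector_diff_chain_at[of "\<lambda>t. x + of_real t * b" b t A' "deriv A' (x + of_real t * b)"]
      by (simp add: o_def)
  qed
  have h: "deriv A holomorphic_on UNIV" using assms by (rule holomorphic_deriv) simp
  show ?thesis
    unfolding harmonic_at_def
  proof (intro exI conjI always_eventually allI)
    show "((\<lambda>t. A (x + of_real t)) has_vector_derivative deriv A (x + of_real t)) (at t)" for t
      using d[OF assms, of 1 t] by simp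
    show "((\<lambda>t. deriv A (x + of_real t)) has_vector_derivative deriv (deriv A) x) (at 0)"
      using d[OF h, of 1 0] by simp
    show "((\<lambda>t. A (x + of_real t * \<i>)) has_vector_derivative \<i> * deriv A (x + of_real t * \<i>)) (at t)" for t
      using d[OF assms, of \<i> t] by simp
    show "((\<lambda>t. \<i> * deriv A (x + of_real t * \<i>)) has_vector_derivative - deriv (deriv A) x) (at 0)"
      using has_vector_derivative_mult_right[OF d[OF h, of \<i> 0], of \<i>] by simp
  qed
qed

lemma harmonic_at_harmonic_poly:
  assumes "harmonic_poly h"
  shows "harmonic_at h x"
proof -
  obtain A B where AB: "A holomorphic_on UNIV" "B holomorphic_on UNIV" "h = (\<lambda>z. A z + cnj (B z))"
    using harmonic_poly_decomposition[OF assms] by blast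
  show ?thesis unfolding AB(3)
    by (intro harmonic_at_add harmonic_at_bounded_linear[OF bounded_linear_cnj] harmonic_at_holomorphic AB)
qed

lemma second_derivative_at_maximum:
  fixes f :: "real \<Rightarrow> real"
  assumes f: "\<forall>\<^sub>F t in nhds 0. (f has_real_derivative p t) (at t)"
    and p: "(p has_real_derivative a) (at 0)"
    and max: "\<forall>\<^sub>F t in nhds 0. f t \<le> f 0"
  shows "a \<le> 0"
proof (rule ccontr)
  assume a: "\<not> a \<le> 0"
  obtain d where d: "d > 0" "\<And>t. \<bar>t\<bar> < d \<Longrightarrow> (f has_real_derivative p t) (at t)" "\<And>t. \<bar>t\<bar> < d \<Longrightarrow> f t \<le> f 0"
    using eventually_conj[OF f max] unfolding eventually_nhds_metric by (auto simp: dist_real_def)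
  have p0: "p 0 = 0"
    by (rule DERIV_local_max[OF d(2) d(1)]) (use d in auto)
  obtain e where e: "e > 0" "\<And>h. 0 < h \<Longrightarrow> h < e \<Longrightarrow> p h > 0"
    using DERIV_pos_inc_right[OF p] a p0 by auto
  define h where "h = min d e / 2"
  have h: "0 < h" "h < d" "h < e" using d e by (auto simp: h_def)
  obtain s where s: "0 < s" "s < h" "f h - f 0 = (h - 0) * p s"
    using MVT2[of 0 h f p] d(2) h by auto
  have "f h - f 0 > 0" using s h e(2)[of s] by simp
  then show False using d(3)[of h] h by simp
qed

text \<open>If w exceeded m inside, then so would w + \<delta> |z|^2 for small \<delta> relative to its boundary
values, and it would have an interior maximum. There both pure second derivatives are at most 0,
while their sum is 4 \<delta>.\<close>
lemma harmonic_maximum_principle: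
  fixes w :: "complex \<Rightarrow> real"
  assumes cont: "continuous_on (cball 0 r) w" and harm: "\<And>x. x \<in> ball 0 r \<Longrightarrow> harmonic_at w x"
    and bd: "\<And>x. x \<in> sphere 0 r \<Longrightarrow> w x \<le> m" and z: "z \<in> ball 0 r"
  shows "w z \<le> m"
proof (rule ccontr)
  assume "\<not> w z \<le> m"
  have r: "r > 0" using z by (metis ball_empty empty_iff not_le)
  \<comment> \<open>small enough for the perturbation to stay below the excess at z on the whole disc\<close>
  define \<delta> where "\<delta> = (w z - m) / (2 * r^2)"
  have \<delta>: "\<delta> > 0" "\<delta> * r^2 < w z - m" using \<open>\<not> w z \<le> m\<close> r by (auto simp: \<delta>_def)
  define v where "v x = w x + \<delta> * (cmod x)^2" for x
  have "continuous_on (cball 0 r) v" unfolding v_def by (intro continuous_intros cont)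
  then obtain y where y: "y \<in> cball 0 r" "\<And>x. x \<in> cball 0 r \<Longrightarrow> v x \<le> v y"
    using continuous_attains_sup[of "cball 0 r" v] r by (metis cball_eq_empty compact_cball not_less_iff_gr_or_eq)
  have "y \<notin> sphere 0 r"
  proof
    assume "y \<in> sphere 0 r"
    then have "v y \<le> m + \<delta> * r^2" using bd by (auto simp: v_def)
    also have "\<dots> < w z" using \<delta> by simp
    also have "\<dots> \<le> v z" using \<delta> by (simp add: v_def)
    also have "\<dots> \<le> v y" using z y by auto
    finally show False by simp
  qed
  then have yb: "y \<in> ball 0 r" using y by auto
  from harm[OF yb] obtain p q a where w:
     "\<forall>\<^sub>F t in nhds 0. ((\<lambda>t. w (y + of_real t)) has_vector_derivative p t) (at t)"
     "(p has_vector_derivative a) (at 0)"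
     "\<forall>\<^sub>F t in nhds 0. ((\<lambda>t. w (y + of_real t * \<i>)) has_vector_derivative q t) (at t)"
     "(q has_vector_derivative - a) (at 0)" unfolding harmonic_at_def by blast
  have near: "\<forall>\<^sub>F t in nhds 0. v (y + of_real t * b) \<le> v (y + of_real 0 * b)" for b
  proof -
    have "((\<lambda>t. y + of_real t * b) \<longlongrightarrow> y + of_real 0 * b) (nhds (0::real))"
      by (intro tendsto_intros filterlim_ident)
    then have "\<forall>\<^sub>F t in nhds 0. y + of_real t * b \<in> ball 0 r"
      using yb by (auto dest!: topological_tendstoD[where S="ball 0 r"])
    then show ?thesis by eventually_elim (use y(2) in auto)
  qed
  have sq: "(cmod (y + of_real t))^2 = (Re y + t)^2 + (Im y)^2"
           "(cmod (y + of_real t * \<i>))^2 = (Re y)^2 + (Im y + t)^2" for t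
    by (simp_all add: cmod_power2)
  have "a + 2 * \<delta> \<le> 0"
  proof (rule second_derivative_at_maximum)
    show "\<forall>\<^sub>F t in nhds 0. ((\<lambda>t. v (y + of_real t)) has_real_derivative p t + \<delta> * (2 * (Re y + t))) (at t)"
      using w(1) unfolding v_def sq
      by eventually_elim (auto intro!: derivative_eq_intros simp: has_real_derivative_iff_has_vector_derivative[symmetric])
    show "((\<lambda>t. p t + \<delta> * (2 * (Re y + t))) has_real_derivative a + 2 * \<delta>) (at 0)"
      using w(2) by (auto intro!: derivative_eq_intros simp: has_real_derivative_iff_has_vector_derivative[symmetric])
    show "\<forall>\<^sub>F t in nhds 0. v (y + of_real t) \<le> v (y + of_real 0)" using near[of 1] by simp
  qed
  moreover have "- a + 2 * \<delta> \<le> 0"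
  proof (rule second_derivative_at_maximum)
    show "\<forall>\<^sub>F t in nhds 0. ((\<lambda>t. v (y + of_real t * \<i>)) has_real_derivative q t + \<delta> * (2 * (Im y + t))) (at t)"
      using w(3) unfolding v_def sq
      by eventually_elim (auto intro!: derivative_eq_intros simp: has_real_derivative_iff_has_vector_derivative[symmetric])
    show "((\<lambda>t. q t + \<delta> * (2 * (Im y + t))) has_real_derivative - a + 2 * \<delta>) (at 0)"
      using w(4) by (auto intro!: derivative_eq_intros simp: has_real_derivative_iff_has_vector_derivative[symmetric])
    show "\<forall>\<^sub>F t in nhds 0. v (y + of_real t * \<i>) \<le> v (y + of_real 0 * \<i>)" using near[of \<i>] .
  qed
  ultimately show False using \<delta> by linarith
qed

text \<open>Rotate f so that its value at z becomes nonnegative, and apply the maximum principle to the real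
part.\<close>
lemma harmonic_maximum_modulus:
  fixes f :: "complex \<Rightarrow> complex"
  assumes cont: "continuous_on (cball 0 r) f" and harm: "\<And>x. x \<in> ball 0 r \<Longrightarrow> harmonic_at f x"
    and bd: "\<And>x. x \<in> sphere 0 r \<Longrightarrow> cmod (f x) \<le> m" and z: "z \<in> ball 0 r"
  shows "cmod (f z) \<le> m"
proof -
  define c where "c = cnj (sgn (f z))"
  have c: "cmod c \<le> 1" by (simp add: c_def norm_sgn)
  have "Re (c * f z) \<le> m"
  proof (rule harmonic_maximum_principle[OF _ _ _ z])
    show "continuous_on (cball 0 r) (\<lambda>z. Re (c * f z))" by (intro continuous_intros cont)
    have "bounded_linear (\<lambda>z. Re (c * z))"
      by (intro bounded_linear_compose[OF bounded_linear_Re] bounded_linear_mult_right)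
    then show "harmonic_at (\<lambda>z. Re (c * f z)) x" if "x \<in> ball 0 r" for x
      using harmonic_at_bounded_linear harm[OF that] by blast
    show "Re (c * f x) \<le> m" if "x \<in> sphere 0 r" for x
    proof -
      have "Re (c * f x) \<le> cmod (c * f x)" by (rule complex_Re_le_cmod)
      also have "\<dots> \<le> 1 * cmod (f x)" unfolding norm_mult using c by (intro mult_right_mono) auto
      also have "\<dots> \<le> m" using bd[OF that] by simp
      finally show ?thesis .
    qed
  qed
  moreover have "c * f z = of_real (cmod (f z))"
  proof (cases "f z = 0")
    case False
    have "c * f z = (f z * cnj (f z)) / of_real (cmod (f z))"
      by (simp add: c_def sgn_div_norm scaleR_conv_of_real field_simps)
    also have "\<dots> = of_real (cmod (f z))"
      using False by (simp add: complex_norm_square[symmetric] power2_eq_square)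
    finally show ?thesis .
  qed simp
  ultimately show ?thesis by simp
qed

text \<open>Poisson's formula holds for harmonic polynomials, both sides depend continuously on the boundary
values in the supremum norm (the left side by the maximum modulus principle), and harmonic
polynomials are dense on the circle.\<close>
lemma harmonic_imp_poisson:
  assumes cont: "continuous_on (cball 0 r) f" and harm: "\<And>x. x \<in> ball 0 r \<Longrightarrow> harmonic_at f x"
    and z: "z \<in> ball 0 r"
  shows "f z = circle_mean (\<lambda>w. f w * poisson_kernel w z) 0 r"
proof -
  have r: "r > 0" using z by (metis ball_empty empty_iff not_le)
  have zs: "z \<notin> sphere 0 r" using z by auto
  have conts: "continuous_on (sphere 0 r) f" using cont by (rule continuous_on_subset) auto
  note contP = continuous_on_poisson_kernel[OF zs]
  have "compact ((\<lambda>w. poisson_kernel w z) ` sphere 0 r)"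
    by (intro compact_continuous_image contP) auto
  then obtain B where B: "B > 0" "\<And>w. w \<in> sphere 0 r \<Longrightarrow> cmod (poisson_kernel w z) \<le> B"
    using compact_imp_bounded bounded_pos by (metis (no_types, lifting) imageI)
  have "cmod (f z - circle_mean (\<lambda>w. f w * poisson_kernel w z) 0 r) \<le> e" if "e > 0" for e
  proof -
    \<comment> \<open>the approximation error enters once through f z and once, magnified by at most B, through the mean\<close>
    define d where "d = e / (1 + B)"
    have d: "d > 0" "d * (1 + B) = e" using that B by (auto simp: d_def)
    obtain h where h: "harmonic_poly h" "\<And>z. z \<in> sphere 0 r \<Longrightarrow> cmod (f z - h z) \<le> d"
      using harmonic_poly_dense_on_sphere[OF conts d(1)] by blast
    obtain A B' where AB: "A holomorphic_on UNIV" "B' holomorphic_on UNIV" "h = (\<lambda>z. A z + cnj (B' z))"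
      using harmonic_poly_decomposition[OF h(1)] by blast
    have cA: "continuous_on X A" "continuous_on X B'" for X
      using AB holomorphic_on_imp_continuous_on continuous_on_subset by blast+
    have ch: "continuous_on X h" for X unfolding AB by (intro continuous_intros cA)
    have "cmod (f z - h z) \<le> d"
    proof (rule harmonic_maximum_modulus[OF _ _ _ z])
      show "continuous_on (cball 0 r) (\<lambda>z. f z - h z)" by (intro continuous_intros cont ch)
      fix x :: complex assume "x \<in> ball 0 r"
      then have "harmonic_at (\<lambda>z. f z + (- h z)) x"
        by (intro harmonic_at_add harm harmonic_at_bounded_linear[OF bounded_linear_minus[OF bounded_linear_ident]]
              harmonic_at_harmonic_poly h(1))
      then show "harmonic_at (\<lambda>z. f z - h z) x" by simp
    qed (use h in auto)
    moreover have "circle_mean (\<lambda>w. h w * poisson_kernel w z) 0 r = h z"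
    proof -
      have "circle_mean (\<lambda>w. h w * poisson_kernel w z) 0 r =
            circle_mean (\<lambda>w. A w * poisson_kernel w z + cnj (B' w * poisson_kernel w z)) 0 r"
        by (simp add: AB cnj_poisson_kernel distrib_right)
      also have "\<dots> = circle_mean (\<lambda>w. A w * poisson_kernel w z) 0 r +
          cnj (circle_mean (\<lambda>w. B' w * poisson_kernel w z) 0 r)"
        unfolding circle_mean_cnj[symmetric]
        by (rule circle_mean_add) (use r in \<open>auto intro!: continuous_intros cA contP\<close>)
      also have "\<dots> = A z + cnj (B' z)"
        using AB z by (simp add: poisson_holomorphic cA holomorphic_on_subset[of _ UNIV])
      finally show ?thesis by (simp add: AB)
    qed
    moreover have "cmod (circle_mean (\<lambda>w. f w * poisson_kernel w z) 0 r - 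
        circle_mean (\<lambda>w. h w * poisson_kernel w z) 0 r) \<le> d * B"
    proof -
      have "circle_mean (\<lambda>w. f w * poisson_kernel w z) 0 r - circle_mean (\<lambda>w. h w * poisson_kernel w z) 0 r
          = circle_mean (\<lambda>w. f w * poisson_kernel w z - h w * poisson_kernel w z) 0 r"
        by (rule circle_mean_diff[symmetric]) (use r in \<open>auto intro!: continuous_intros conts ch contP\<close>)
      also have "cmod \<dots> \<le> d * B"
      proof (rule circle_mean_norm_le)
        fix w :: complex assume w: "w \<in> sphere 0 r"
        have "cmod (f w * poisson_kernel w z - h w * poisson_kernel w z) =
            cmod (f w - h w) * cmod (poisson_kernel w z)"
          by (metis left_diff_distrib norm_mult)
        also have "\<dots> \<le> d * B" using h(2)[OF w] B(2)[OF w] d by (intro mult_mono) auto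
        finally show "cmod (f w * poisson_kernel w z - h w * poisson_kernel w z) \<le> d * B" .
      qed (use r in \<open>auto intro!: continuous_intros conts ch contP\<close>)
      finally show ?thesis .
    qed
    ultimately have "cmod (f z - circle_mean (\<lambda>w. f w * poisson_kernel w z) 0 r) \<le> d + d * B"
      using norm_triangle_mono norm_minus_commute by (metis (no_types, lifting) diff_add_cancel add_diff_eq)
    then show ?thesis using d by (simp add: algebra_simps)
  qed
  then have "cmod (f z - circle_mean (\<lambda>w. f w * poisson_kernel w z) 0 r) \<le> 0"
    by (rule field_le_epsilon) simp
  then show ?thesis by simp
qed

lemma harmonic_on_imp_harmonic_at:
  assumes F: "harmonic_on F S" and S: "open S" "x \<in> S"
  shows "harmonic_at F x"
proof -
  define \<psi> where "\<psi> b t = dir_deriv b F (x + of_real t * b)" for b t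
  have *: "\<forall>\<^sub>F t in nhds 0. ((\<lambda>t. F (x + of_real t * b)) has_vector_derivative \<psi> b t) (at t)"
          "(\<psi> b has_vector_derivative dir_deriv b (dir_deriv b F) x) (at 0)" if b: "b \<in> Basis" for b
  proof -
    have "((\<lambda>t. x + of_real t * b) \<longlongrightarrow> x + of_real 0 * b) (nhds (0::real))"
      by (intro tendsto_intros filterlim_ident)
    then have "\<forall>\<^sub>F t in nhds 0. x + of_real t * b \<in> S"
      using S by (auto dest!: topological_tendstoD[where S=S])
    then show "\<forall>\<^sub>F t in nhds 0. ((\<lambda>t. F (x + of_real t * b)) has_vector_derivative \<psi> b t) (at t)"
    proof eventually_elim
      case (elim t)
      then have "(\<lambda>s. F (x + of_real t * b + s *\<^sub>R b)) differentiable (at 0)"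
        using F b unfolding harmonic_on_def C2_on_def C1_on_def by blast
      then have "((\<lambda>s. F (x + of_real t * b + s *\<^sub>R b)) has_vector_derivative \<psi> b t) (at (t - t))"
        unfolding \<psi>_def dir_deriv_def by (simp add: vector_derivative_works)
      moreover have "((\<lambda>s. s - t) has_vector_derivative 1) (at t)"
        by (auto intro!: derivative_eq_intros)
      ultimately show ?case
        using vector_diff_chain_at[of "\<lambda>s. s - t" 1 t "\<lambda>s. F (x + of_real t * b + s *\<^sub>R b)" "\<psi> b t"]
        by (simp add: o_def scaleR_conv_of_real algebra_simps)
    qed
    have "(\<lambda>s. dir_deriv b F (x + s *\<^sub>R b)) differentiable (at 0)"
      using F b S unfolding harmonic_on_def C2_on_def C1_on_def by blast
    then show "(\<psi> b has_vector_derivative dir_deriv b (dir_deriv b F) x) (at 0)"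
      unfolding \<psi>_def dir_deriv_def[of b "dir_deriv b F"]
      by (simp add: vector_derivative_works scaleR_conv_of_real)
  qed
  have "dir_deriv 1 (dir_deriv 1 F) x + dir_deriv \<i> (dir_deriv \<i> F) x = 0"
    using F S unfolding harmonic_on_def laplacian_def by (auto simp: Basis_complex_def)
  then have "dir_deriv \<i> (dir_deriv \<i> F) x = - dir_deriv 1 (dir_deriv 1 F) x"
    by (simp add: eq_neg_iff_add_eq_0 add.commute)
  then show ?thesis
    using *[of 1] *[of \<i>] unfolding harmonic_at_def
    by (intro exI[of _ "\<psi> 1"] exI[of _ "\<psi> \<i>"] exI[of _ "dir_deriv 1 (dir_deriv 1 F) x"])
       (simp add: Basis_complex_def)
qed

lemma harmonic_at_translate:
  "harmonic_at (\<lambda>\<zeta>. g (x + \<zeta>)) 0 \<longleftrightarrow> harmonic_at g x"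
  by (simp add: harmonic_at_def)

section \<open>Higher derivatives under Moebius maps\<close>

lemma holomorphic_on_comp:
  assumes "\<phi> holomorphic_on S" "L holomorphic_on T" "\<And>w. w \<in> S \<Longrightarrow> \<phi> w \<in> T"
  shows "(\<lambda>w. L (\<phi> w)) holomorphic_on S"
  using holomorphic_on_compose_gen[OF assms(1,2)] assms(3) by (auto simp: o_def image_subset_iff)

lemma higher_deriv_linear_mult:
  assumes "X holomorphic_on S" "open S" "w \<in> S"
  shows "(deriv ^^ Suc n) (\<lambda>w. (1 + c * w) * X w) w =
         (1 + c * w) * (deriv ^^ Suc n) X w + of_nat (Suc n) * c * (deriv ^^ n) X w"
proof -
  have L: "(deriv ^^ i) (\<lambda>w. 1 + c * w) = (\<lambda>w. if i = 0 then 1 + c * w else if i = 1 then c else 0)" for i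
  proof (induction i)
    case (Suc i)
    have "deriv (\<lambda>w. 1 + c * w) = (\<lambda>w. c)"
      by (rule ext, rule DERIV_imp_deriv) (auto intro!: derivative_eq_intros)
    then show ?case using Suc by auto
  qed auto
  have "(deriv ^^ Suc n) (\<lambda>w. (1 + c * w) * X w) w =
     (\<Sum>i = 0..Suc n. of_nat (Suc n choose i) * (deriv ^^ i) (\<lambda>w. 1 + c * w) w * (deriv ^^ (Suc n - i)) X w)"
    by (rule higher_deriv_mult[OF _ assms]) (intro holomorphic_intros)
  also have "\<dots> = (\<Sum>i\<in>{0,1}. of_nat (Suc n choose i) * (deriv ^^ i) (\<lambda>w. 1 + c * w) w * (deriv ^^ (Suc n - i)) X w)"
    by (rule sum.mono_neutral_right) (auto simp: L)
  also have "\<dots> = (1 + c * w) * (deriv ^^ Suc n) X w + of_nat (Suc n) * c * (deriv ^^ n) X w"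
    unfolding L by simp
  finally show ?thesis .
qed

text \<open>Bol's lemma for the Moebius map \<phi> w = (w + z) / (1 + c w). In general, the derivative of order
n = k + 1 intertwines the weights (1 - n) / 2 and (1 + n) / 2 of \<phi>'; here \<phi>' is
(1 - c z) / (1 + c w)^2. The proof is an induction on k: passing from k to k + 1 multiplies the
function on the left by 1 + c w, and the two terms of Leibniz' rule recombine. At w = 0 with
c = cnj z the lemma expresses the derivative of H at z by Taylor coefficients at 0 of the composition
of H and \<phi>.\<close>
lemma Bol_Moebius:
  assumes S: "open S" and T: "open T" and H: "H holomorphic_on T"
    and ne: "\<And>w. w \<in> S \<Longrightarrow> 1 + c * w \<noteq> 0"
    and \<phi>: "\<And>w. w \<in> S \<Longrightarrow> (w + z) / (1 + c * w) \<in> T"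
    and w: "w \<in> S"
  shows "(deriv ^^ Suc k) (\<lambda>w. (1 + c * w) ^ k * H ((w + z) / (1 + c * w))) w =
     (1 - c * z) ^ Suc k / (1 + c * w) ^ (k + 2) * (deriv ^^ Suc k) H ((w + z) / (1 + c * w))"
  using w
proof (induction k arbitrary: w)
  have D\<phi>: "((\<lambda>w. (w + z) / (1 + c * w)) has_field_derivative (1 - c * z) / (1 + c * w) ^ 2) (at w)"
    if "w \<in> S" for w
    using ne[OF that] by (auto intro!: derivative_eq_intros simp: field_simps power2_eq_square)
  have DH: "((\<lambda>w. (deriv ^^ n) H ((w + z) / (1 + c * w))) has_field_derivative
       (deriv ^^ Suc n) H ((w + z) / (1 + c * w)) * ((1 - c * z) / (1 + c * w) ^ 2)) (at w)"
    if "w \<in> S" for w n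
  proof -
    have "((deriv ^^ n) H has_field_derivative (deriv ^^ Suc n) H ((w + z) / (1 + c * w))) (at ((w + z) / (1 + c * w)))"
      using has_field_derivative_higher_deriv[OF H T \<phi>[OF that], of n] by simp
    then show ?thesis using DERIV_chain2[OF _ D\<phi>[OF that]] by blast
  qed
  {
    case 0
    then show ?case using DERIV_imp_deriv[OF DH[OF 0, of 0]] by (simp add: power2_eq_square mult_ac)
  next
    case (Suc k)
    define X where "X w = (1 + c * w) ^ k * H ((w + z) / (1 + c * w))" for w
    define Y where "Y w = (1 - c * z) ^ Suc k * ((deriv ^^ Suc k) H ((w + z) / (1 + c * w)) / (1 + c * w) ^ (k + 2))" for w
    have hH\<phi>: "(\<lambda>w. (deriv ^^ n) H ((w + z) / (1 + c * w))) holomorphic_on S" for n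
      using DH S by (auto simp: holomorphic_on_open)
    have hX: "X holomorphic_on S" unfolding X_def using hH\<phi>[of 0]
      by (auto intro!: holomorphic_intros)
    have X: "(deriv ^^ Suc k) X x = Y x" if "x \<in> S" for x
      using Suc.IH[OF that] by (simp only: X_def[abs_def] Y_def times_divide_eq_left times_divide_eq_right)
    define u where "u = 1 + c * w"
    define E where "E n = (deriv ^^ n) H ((w + z) / (1 + c * w))" for n
    define y where "y = (1 - c * z) ^ Suc k * ((E (Suc (Suc k)) * ((1 - c * z) / u ^ 2) * u ^ (k + 2)
        - E (Suc k) * (of_nat (k + 2) * c * u ^ (k + 1))) / (u ^ (k + 2) * u ^ (k + 2)))"
    have u: "u \<noteq> 0" using ne[OF Suc.prems] by (simp add: u_def)
    have Du: "((\<lambda>w. (1 + c * w) ^ (k + 2)) has_field_derivative of_nat (k + 2) * c * u ^ (k + 1)) (at w)"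
    proof -
      have "((\<lambda>w. 1 + c * w) has_field_derivative c) (at w)" by (auto intro!: derivative_eq_intros)
      from DERIV_power[OF this, of "k + 2"] show ?thesis by (simp add: u_def mult_ac)
    qed
    have "(Y has_field_derivative y) (at w)"
      using DERIV_cmult[OF DERIV_divide[OF DH[OF Suc.prems, of "Suc k"] Du], of "(1 - c * z) ^ Suc k"] u
      unfolding y_def E_def u_def by (simp only: Y_def[abs_def] power_not_zero not_False_eq_True)
    then have "((deriv ^^ Suc k) X has_field_derivative y) (at w)"
      using X Suc.prems S by (metis has_field_derivative_transform_within_open)
    then have "(deriv ^^ Suc (Suc k)) X w = y"
      by (simp add: DERIV_imp_deriv)
    moreover have "(deriv ^^ Suc (Suc k)) (\<lambda>w. (1 + c * w) ^ Suc k * H ((w + z) / (1 + c * w))) w =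
       (1 + c * w) * (deriv ^^ Suc (Suc k)) X w + of_nat (k + 2) * c * (deriv ^^ Suc k) X w"
      using higher_deriv_linear_mult[OF hX S Suc.prems, of "Suc k" c] by (simp add: X_def mult.assoc)
    moreover have "u * y + of_nat (k + 2) * c * Y w = (1 - c * z) ^ Suc (Suc k) / u ^ (Suc k + 2) * E (Suc (Suc k))"
    proof -
      have alg: "u * (D * ((e' * (d / u ^ 2) * (P * u) - e * (n * c * P)) / ((P * u) * (P * u)))) + n * c * (D * (e / (P * u)))
            = (D * d) / (P * u * u) * e'" if "P \<noteq> 0" for D e e' d P n :: complex
      proof -
        have "u * (D * ((e' * (d / u ^ 2) * (P * u) - e * (n * c * P)) / ((P * u) * (P * u))))
            = D * (e' * d) / (P * u * u) - n * c * (D * (e / (P * u)))"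
          using u that by (simp add: divide_simps power2_eq_square) (simp add: algebra_simps)
        then show ?thesis by simp
      qed
      have pows: "u ^ (k + 2) = u ^ (k + 1) * u" "u ^ (Suc k + 2) = u ^ (k + 1) * u * u"
         "(1 - c * z) ^ Suc (Suc k) = (1 - c * z) ^ Suc k * (1 - c * z)" by simp_all
      have Yw: "Y w = (1 - c * z) ^ Suc k * (E (Suc k) / u ^ (k + 2))" by (simp only: Y_def E_def u_def)
      have "u ^ (k + 1) \<noteq> 0" using u by simp
      then show ?thesis unfolding y_def Yw pows by (rule alg)
    qed
    ultimately show ?case using X[OF Suc.prems] by (simp only: u_def E_def)
  }
qed

lemma higher_deriv_one_plus_power:
  "(deriv ^^ i) (\<lambda>w. (1 + c * w) ^ k) 0 = fact i * of_nat (k choose i) * (c::complex) ^ i"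
proof -
  have "(deriv ^^ i) (\<lambda>w. (c * w + 1) ^ k) 0 = c ^ i * (deriv ^^ i) (\<lambda>w. w ^ k) (c * 0 + 1)"
    by (rule higher_deriv_compose_linear'[of _ UNIV UNIV]) (auto intro!: holomorphic_intros)
  also have "(deriv ^^ i) (\<lambda>w::complex. w ^ k) (c * 0 + 1) = fact i * of_nat (k choose i)"
  proof -
    have "(deriv ^^ i) (\<lambda>w::complex. w ^ k) = (\<lambda>w. fact i * of_nat (k choose i) * w ^ (k - i))"
    proof (induction i)
      case (Suc i)
      have "deriv (\<lambda>w::complex. fact i * of_nat (k choose i) * w ^ (k - i)) =
         (\<lambda>w. fact (Suc i) * of_nat (k choose Suc i) * w ^ (k - Suc i))"
      proof
        fix w :: complex
        have "(k - i) * (k choose i) = Suc i * (k choose Suc i)"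
          using binomial_absorb_comp binomial_absorption[of i k] 
          by (metis binomial_absorption diff_Suc_1 mult.commute)
        then have *: "of_nat (k - i) * of_nat (k choose i) = of_nat (Suc i) * (of_nat (k choose Suc i)::complex)"
          by (metis of_nat_mult)
        have "deriv (\<lambda>w::complex. fact i * of_nat (k choose i) * w ^ (k - i)) w =
              fact i * of_nat (k choose i) * (of_nat (k - i) * w ^ (k - i - 1))"
          by (rule DERIV_imp_deriv) (auto intro!: derivative_eq_intros)
        also have "\<dots> = fact i * (of_nat (k - i) * of_nat (k choose i)) * w ^ (k - Suc i)" by simp
        also have "\<dots> = fact (Suc i) * of_nat (k choose Suc i) * w ^ (k - Suc i)" unfolding * by simp
        finally show "deriv (\<lambda>w::complex. fact i * of_nat (k choose i) * w ^ (k - i)) w =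
           fact (Suc i) * of_nat (k choose Suc i) * w ^ (k - Suc i)" .
      qed
      then show ?case using Suc by simp
    qed auto
    then show ?thesis by simp
  qed
  finally show ?thesis by (simp add: add.commute mult_ac)
qed

section \<open>Derivative bounds for harmonic functions in the disc\<close>

text \<open>A bound for all Fourier coefficients of positive index of functions with values in V. The bounds for
derivatives are derived from this condition, since they are needed for two sets V: for a disc the
optimal constant is the radius, for a real interval it is smaller by the factor 2 / pi.\<close>
definition coeff_bound :: "complex set \<Rightarrow> real \<Rightarrow> bool" where
  "coeff_bound V C \<longleftrightarrow> (\<forall>g m r. r > 0 \<longrightarrow> m > 0 \<longrightarrow> continuous_on (sphere 0 r) g \<longrightarrow>
      g ` sphere 0 r \<subseteq> V \<longrightarrow> cmod (circle_mean (\<lambda>w. g w / w ^ m) 0 r) \<le> C / r ^ m)"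

text \<open>The Fourier coefficient on the circle of radius r < 1 is the Taylor coefficient; let r tend to 1.\<close>
lemma coeff_bound_derivative_at_0:
  assumes V: "coeff_bound V C"
    and H: "H holomorphic_on ball 0 1" and K: "K holomorphic_on ball 0 1"
    and f: "\<And>z. z \<in> ball 0 1 \<Longrightarrow> f z = H z + cnj (K z)" "f ` ball 0 1 \<subseteq> V" and m: "m > 0"
  shows "cmod ((deriv ^^ m) H 0) \<le> fact m * C"
proof -
  have contHK: "continuous_on (ball 0 1) H" "continuous_on (ball 0 1) K"
    using H K holomorphic_on_imp_continuous_on by blast+
  have bd: "cmod ((deriv ^^ m) H 0 / fact m) \<le> C / r ^ m" if r: "r \<in> {0<..<1}" for r :: real
  proof -
    have sub: "cball (0::complex) r \<subseteq> ball 0 1" "sphere (0::complex) r \<subseteq> ball 0 1" using r by auto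
    have "continuous_on (ball 0 1) f"
      by (rule continuous_on_eq[of _ "\<lambda>z. H z + cnj (K z)"]) (use f contHK in \<open>auto intro!: continuous_intros\<close>)
    then have "continuous_on (sphere 0 r) f" using sub continuous_on_subset by blast
    moreover have "f ` sphere 0 r \<subseteq> V" using f(2) image_mono[OF sub(2), of f] by (rule order_trans[rotated])
    ultimately have "cmod (circle_mean (\<lambda>w. f w / w ^ m) 0 r) \<le> C / r ^ m"
      using V[unfolded coeff_bound_def, rule_format, of r m f] r m by simp
    then show ?thesis using harmonic_coeff_formula[OF H K f(1) sub(1) _ m] r by simp
  qed
  have "cmod ((deriv ^^ m) H 0 / fact m) \<le> C"
  proof (rule tendsto_lowerbound)
    have "((\<lambda>r. C / r ^ m) \<longlongrightarrow> C / 1 ^ m) (at_left (1::real))" by (intro tendsto_intros) auto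
    then show "((\<lambda>r. C / r ^ m) \<longlongrightarrow> C) (at_left (1::real))" by simp
    show "\<forall>\<^sub>F r in at_left 1. cmod ((deriv ^^ m) H 0 / fact m) \<le> C / r ^ m"
      using eventually_at_left_real[of 0 "1::real"] by (auto elim!: eventually_mono intro!: bd)
  qed auto
  then show ?thesis by (simp add: norm_divide field_simps)
qed

text \<open>Composition with the disc automorphism \<phi> that maps 0 to z keeps the values in V, so the Taylor
coefficients of G, the composition of H and \<phi>, are at most C. By Bol's lemma the derivative of H
at z is, up to the power of 1 - |z|^2, the derivative at 0 of (1 + cnj z w)^k G(w). In Leibniz' rule
the value G 0, on which there is no bound, carries the coefficient of w^(k+1) in (1 + cnj z w)^k,
which vanishes; the other terms sum to (1 + |z|)^k by the binomial theorem.\<close>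
lemma coeff_bound_derivative_unit_disc:
  assumes V: "coeff_bound V C"
    and H: "H holomorphic_on ball 0 1" and K: "K holomorphic_on ball 0 1"
    and f: "\<And>z. z \<in> ball 0 1 \<Longrightarrow> f z = H z + cnj (K z)" "f ` ball 0 1 \<subseteq> V" and z: "z \<in> ball 0 1"
  shows "cmod ((deriv ^^ Suc k) H z) \<le>
    fact (Suc k) * C * (1 + cmod z) ^ k / (1 - (cmod z)^2) ^ Suc k"
proof -
  define c where "c = cnj z"
  define \<phi> where "\<phi> w = (w + z) / (1 + c * w)" for w
  have \<phi>_eq: "\<phi> w = Moebius_function 0 (- z) w" for w
    by (simp add: \<phi>_def c_def Moebius_function_simple)
  have \<phi>: "\<phi> w \<in> ball 0 1" if "w \<in> ball 0 1" for w
    using Moebius_function_norm_lt_1[of "- z" w 0] that z by (simp add: \<phi>_eq)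
  have h\<phi>: "\<phi> holomorphic_on ball 0 1"
    using Moebius_function_holomorphic[of "- z" 0] z by (simp add: \<phi>_eq[abs_def])
  have ne: "1 + c * w \<noteq> 0" if "w \<in> ball 0 1" for w
  proof
    assume "1 + c * w = 0"
    then have "cmod (c * w) = 1" by (metis add_eq_0_iff norm_minus_cancel norm_one)
    moreover have "cmod c * cmod w < 1 * 1" using that z
      by (intro mult_strict_mono') (auto simp: c_def)
    ultimately show False by (simp add: norm_mult)
  qed
  define G where "G = (\<lambda>w. H (\<phi> w))"
  have comp: "(\<lambda>w. L (\<phi> w)) holomorphic_on ball 0 1" if "L holomorphic_on ball 0 1" for L
    by (rule holomorphic_on_comp[OF h\<phi> that \<phi>])
  have G: "cmod ((deriv ^^ m) G 0) \<le> fact m * C" if "m > 0" for m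
    by (rule coeff_bound_derivative_at_0[OF V, of _ "\<lambda>w. K (\<phi> w)" "\<lambda>w. f (\<phi> w)"])
       (use comp H K f \<phi> that in \<open>auto simp: G_def\<close>)
  have C: "C \<ge> 0" using G[of 1] norm_ge_zero[of "deriv G 0"] by (simp del: norm_ge_zero)
  have "(1 - c * z) ^ Suc k * (deriv ^^ Suc k) H z = (deriv ^^ Suc k) (\<lambda>w. (1 + c * w) ^ k * G w) 0"
    using Bol_Moebius[OF _ _ H, of "ball 0 1" c z 0 k] ne \<phi> by (simp add: G_def \<phi>_def)
  also have "\<dots> = (\<Sum>i = 0..Suc k. of_nat (Suc k choose i) * (deriv ^^ i) (\<lambda>w. (1 + c * w) ^ k) 0 * (deriv ^^ (Suc k - i)) G 0)"
    by (rule higher_deriv_mult[of _ "ball 0 1"]) (use comp[OF H] in \<open>auto intro!: holomorphic_intros simp: G_def\<close>)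
  also have "\<dots> = (\<Sum>i = 0..Suc k. of_nat (Suc k choose i) * (fact i * of_nat (k choose i) * c ^ i) * (deriv ^^ (Suc k - i)) G 0)"
    by (simp only: higher_deriv_one_plus_power)
  also have "\<dots> = (\<Sum>i\<le>k. of_nat (Suc k choose i) * (fact i * of_nat (k choose i) * c ^ i) * (deriv ^^ (Suc k - i)) G 0)"
    by (rule sum.mono_neutral_right) (auto simp: not_le)
  also have "cmod \<dots> \<le> (\<Sum>i\<le>k. fact (Suc k) * C * (of_nat (k choose i) * cmod z ^ i))"
  proof (rule sum_norm_le)
    fix i assume i: "i \<in> {..k}"
    have "cmod (of_nat (Suc k choose i) * (fact i * of_nat (k choose i) * c ^ i) * (deriv ^^ (Suc k - i)) G 0)
      = (of_nat (Suc k choose i) * (fact i * of_nat (k choose i) * cmod z ^ i)) * cmod ((deriv ^^ (Suc k - i)) G 0)"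
      by (simp add: norm_mult norm_power c_def)
    also have "\<dots> \<le> (of_nat (Suc k choose i) * (fact i * of_nat (k choose i) * cmod z ^ i)) * (fact (Suc k - i) * C)"
      by (intro mult_left_mono G) (use i in auto)
    also have "\<dots> = (fact i * fact (Suc k - i) * of_nat (Suc k choose i)) * C * (of_nat (k choose i) * cmod z ^ i)"
      by (simp only: mult_ac)
    also have "fact i * fact (Suc k - i) * of_nat (Suc k choose i) = (fact (Suc k) :: real)"
      using binomial_fact_lemma[of i "Suc k"] i by (metis atMost_iff le_SucI of_nat_fact of_nat_mult)
    finally show "cmod (of_nat (Suc k choose i) * (fact i * of_nat (k choose i) * c ^ i) * (deriv ^^ (Suc k - i)) G 0)
      \<le> fact (Suc k) * C * (of_nat (k choose i) * cmod z ^ i)" .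
  qed
  also have "\<dots> = fact (Suc k) * C * (cmod z + 1) ^ k"
    by (simp add: binomial_ring sum_distrib_left)
  finally have "cmod ((1 - c * z) ^ Suc k * (deriv ^^ Suc k) H z) \<le> fact (Suc k) * C * (1 + cmod z) ^ k"
    by (simp add: add.commute)
  moreover have pos: "(1 - (cmod z)^2) ^ Suc k > 0"
    using z by (intro zero_less_power) (simp add: power_less_one_iff abs_square_less_1)
  moreover have "1 - c * z = of_real (1 - (cmod z)^2)"
    by (simp only: c_def of_real_diff of_real_1 complex_norm_square mult.commute)
  then have "(1 - c * z) ^ Suc k = of_real ((1 - (cmod z)^2) ^ Suc k)"
    by (simp only: of_real_power)
  ultimately have "(1 - (cmod z)^2) ^ Suc k * cmod ((deriv ^^ Suc k) H z) \<le> fact (Suc k) * C * (1 + cmod z) ^ k"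
    by (simp only: norm_mult norm_of_real abs_of_pos)
  then show ?thesis using pos_le_divide_eq[OF pos] by (metis mult.commute)
qed

lemma coeff_bound_derivative:
  assumes V: "coeff_bound V C" and r: "r > 0"
    and H: "H holomorphic_on ball 0 r" and K: "K holomorphic_on ball 0 r"
    and f: "\<And>z. z \<in> ball 0 r \<Longrightarrow> f z = H z + cnj (K z)" "f ` ball 0 r \<subseteq> V" and z: "z \<in> ball 0 r"
  shows "cmod ((deriv ^^ Suc k) H z) \<le>
    fact (Suc k) * C * (1 + cmod z / r) ^ k / (1 - (cmod z / r)^2) ^ Suc k / r ^ Suc k"
proof -
  have in_ball: "of_real r * w \<in> ball 0 r" if "w \<in> ball 0 1" for w :: complex
    using that r by (simp add: norm_mult)
  have comp: "(\<lambda>w. L (of_real r * w)) holomorphic_on ball 0 1" if "L holomorphic_on ball 0 r" for L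
    by (rule holomorphic_on_comp[OF _ that]) (use in_ball in \<open>auto intro!: holomorphic_intros\<close>)
  have z1: "z / of_real r \<in> ball 0 1" using z r by (simp add: norm_divide)
  have "(deriv ^^ Suc k) (\<lambda>w. H (of_real r * w)) (z / of_real r) =
      of_real r ^ Suc k * (deriv ^^ Suc k) H (of_real r * (z / of_real r))"
    by (rule higher_deriv_compose_linear[OF H _ _ z1]) (use in_ball in auto)
  then have "cmod ((deriv ^^ Suc k) (\<lambda>w. H (of_real r * w)) (z / of_real r)) = r ^ Suc k * cmod ((deriv ^^ Suc k) H z)"
    using r by (simp add: norm_mult norm_power del: power_Suc funpow.simps)
  moreover have "cmod ((deriv ^^ Suc k) (\<lambda>w. H (of_real r * w)) (z / of_real r)) \<le>
    fact (Suc k) * C * (1 + cmod (z / of_real r)) ^ k / (1 - (cmod (z / of_real r))^2) ^ Suc k"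
    by (rule coeff_bound_derivative_unit_disc[OF V comp[OF H] comp[OF K], of "\<lambda>w. f (of_real r * w)"])
       (use z1 in_ball f in auto)
  ultimately have "r ^ Suc k * cmod ((deriv ^^ Suc k) H z) \<le>
    fact (Suc k) * C * (1 + cmod z / r) ^ k / (1 - (cmod z / r)^2) ^ Suc k"
    using r by (simp only: norm_divide norm_of_real abs_of_pos)
  moreover have "r ^ Suc k > 0" using r by simp
  ultimately show ?thesis using pos_le_divide_eq[of "r ^ Suc k"] by (metis mult.commute)
qed

lemma coeff_bound_cball: "coeff_bound (cball 0 M) M"
  unfolding coeff_bound_def
proof (intro allI impI)
  fix g :: "complex \<Rightarrow> complex" and m :: nat and r :: real
  assume a: "r > 0" "m > 0" "continuous_on (sphere 0 r) g" "g ` sphere 0 r \<subseteq> cball 0 M"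
  show "cmod (circle_mean (\<lambda>w. g w / w ^ m) 0 r) \<le> M / r ^ m"
  proof (rule circle_mean_norm_le)
    show "continuous_on (sphere 0 r) (\<lambda>w. g w / w ^ m)" using a by (auto intro!: continuous_intros)
    show "cmod (g w / w ^ m) \<le> M / r ^ m" if "w \<in> sphere 0 r" for w
    proof -
      have "g w \<in> cball 0 M" using a(4) imageI[OF that] by (rule subsetD)
      then have "cmod (g w) \<le> M" by simp
      then show ?thesis using that a(1) by (simp add: norm_divide norm_power divide_right_mono)
    qed
  qed (use a in auto)
qed

text \<open>The map w \<mapsto> u w^m preserves the normalized arc length. For harmonic polynomials both means are the
value at 0; the general case follows by density.\<close>
lemma circle_mean_compose_power:
  assumes g: "continuous_on (sphere 0 1) g" and u: "cmod u = 1" and m: "m > 0"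
  shows "circle_mean (\<lambda>w. g (u * w ^ m)) 0 1 = circle_mean g 0 1"
proof -
  have in_sphere: "u * w ^ m \<in> sphere 0 1" if "w \<in> sphere 0 1" for w
    using that u by (simp add: norm_mult norm_power)
  have cont: "continuous_on (sphere 0 1) (\<lambda>w. h (u * w ^ m))" if "continuous_on (sphere 0 1) h" for h :: "complex \<Rightarrow> complex"
    by (rule continuous_on_compose2[OF that]) (use in_sphere in \<open>auto intro!: continuous_intros\<close>)
  have "cmod (circle_mean (\<lambda>w. g (u * w ^ m)) 0 1 - circle_mean g 0 1) \<le> e" if "e > 0" for e
  proof -
    obtain h where h: "harmonic_poly h" "\<And>z. z \<in> sphere 0 1 \<Longrightarrow> cmod (g z - h z) \<le> e / 2"
      using harmonic_poly_dense_on_sphere[OF g, of "e/2"] \<open>e > 0\<close> by auto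
    obtain A B where AB: "A holomorphic_on UNIV" "B holomorphic_on UNIV" "h = (\<lambda>z. A z + cnj (B z))"
      using harmonic_poly_decomposition[OF h(1)] by blast
    have cAB: "continuous_on X A" "continuous_on X B" for X
      using AB holomorphic_on_imp_continuous_on continuous_on_subset by blast+
    have ch: "continuous_on X h" for X unfolding AB by (intro continuous_intros cAB)
    have mean: "circle_mean (\<lambda>w. h (v * w ^ n)) 0 1 = h 0" if n: "n > 0" for v n
    proof -
      have hol: "(\<lambda>w. L (v * w ^ n)) holomorphic_on X" if "L holomorphic_on UNIV" for L X
        by (rule holomorphic_on_comp[OF _ that]) (auto intro!: holomorphic_intros)
      have cont': "continuous_on X (\<lambda>w. L (v * w ^ n))" if "L holomorphic_on UNIV" for L X
        by (rule holomorphic_on_imp_continuous_on[OF hol[OF that]])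
      note hA = hol[OF AB(1)] and hB = hol[OF AB(2)] and cA = cont'[OF AB(1)] and cB = cont'[OF AB(2)]
      have "circle_mean (\<lambda>w. h (v * w ^ n)) 0 1 =
          circle_mean (\<lambda>w. A (v * w ^ n)) 0 1 + cnj (circle_mean (\<lambda>w. B (v * w ^ n)) 0 1)"
        unfolding AB(3) circle_mean_cnj[symmetric]
        by (rule circle_mean_add[OF cA continuous_on_cnj[OF cB]]) simp
      also have "\<dots> = A 0 + cnj (B 0)"
        using n circle_mean_holomorphic[OF cA hA] circle_mean_holomorphic[OF cB hB] by (simp add: zero_power)
      finally show ?thesis by (simp add: AB)
    qed
    have 1: "cmod (circle_mean (\<lambda>w. g (u * w ^ m)) 0 1 - h 0) \<le> e / 2"
    proof -
      have "circle_mean (\<lambda>w. g (u * w ^ m)) 0 1 - h 0 = circle_mean (\<lambda>w. g (u * w ^ m) - h (u * w ^ m)) 0 1"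
        unfolding mean[OF m, of u, symmetric] by (rule circle_mean_diff[symmetric]) (auto intro!: cont g ch)
      also have "cmod \<dots> \<le> e / 2"
        by (rule circle_mean_norm_le) (use h(2)[OF in_sphere] in \<open>auto intro!: continuous_intros cont g ch\<close>)
      finally show ?thesis .
    qed
    have 2: "cmod (circle_mean g 0 1 - h 0) \<le> e / 2"
    proof -
      have "circle_mean g 0 1 - h 0 = circle_mean (\<lambda>w. g w - h w) 0 1"
        using mean[of 1 1] by (simp add: circle_mean_diff g ch)
      also have "cmod \<dots> \<le> e / 2"
        by (rule circle_mean_norm_le) (use h(2) in \<open>auto intro!: continuous_intros g ch\<close>)
      finally show ?thesis .
    qed
    show ?thesis
      using norm_triangle_ineq4[of "circle_mean (\<lambda>w. g (u * w ^ m)) 0 1 - h 0" "circle_mean g 0 1 - h 0"] 1 2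
      by simp
  qed
  then have "cmod (circle_mean (\<lambda>w. g (u * w ^ m)) 0 1 - circle_mean g 0 1) \<le> 0"
    by (rule field_le_epsilon) simp
  then show ?thesis by simp
qed

lemma circle_mean_abs_Re: "circle_mean (\<lambda>w. of_real \<bar>Re w\<bar>) 0 1 = of_real (2 / pi)"
proof -
  have D: "((\<lambda>t. sin (2 * pi * t) / (2 * pi)) has_vector_derivative cos (2 * pi * t)) (at t within A)" for t A
    unfolding has_real_derivative_iff_has_vector_derivative[symmetric]
    by (auto intro!: derivative_eq_intros)
  have I: "((\<lambda>t. cos (2 * pi * t)) has_integral sin (2 * pi * b) / (2 * pi) - sin (2 * pi * a) / (2 * pi)) {a..b}"
    if "a \<le> b" for a b
    by (rule fundamental_theorem_of_calculus[OF that D])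
  have 1: "((\<lambda>t. \<bar>cos (2 * pi * t)\<bar>) has_integral 1 / (2 * pi)) {0..1/4}"
  proof (rule has_integral_eq)
    show "((\<lambda>t. cos (2 * pi * t)) has_integral 1 / (2 * pi)) {0..1/4}" using I[of 0 "1/4"] by simp
    show "cos (2 * pi * t) = \<bar>cos (2 * pi * t)\<bar>" if "t \<in> {0..1/4}" for t
    proof -
      have "2 * pi * t \<le> 2 * pi * (1/4)" using that by (intro mult_left_mono) auto
      then have "cos (2 * pi * t) \<ge> 0" using that by (intro cos_ge_zero) (auto intro: order_trans[of _ 0])
      then show ?thesis by simp
    qed
  qed
  have s3: "sin (2 * pi * (3/4)) = - 1"
  proof -
    have "2 * pi * (3/4) = pi + pi / 2" by simp
    then show ?thesis by (simp only: sin_add) simp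
  qed
  have 2: "((\<lambda>t. \<bar>cos (2 * pi * t)\<bar>) has_integral 2 / (2 * pi)) {1/4..3/4}"
  proof (rule has_integral_eq)
    show "((\<lambda>t. - cos (2 * pi * t)) has_integral 2 / (2 * pi)) {1/4..3/4}"
      using has_integral_neg[OF I[of "1/4" "3/4"]] s3 by (simp add: field_simps)
    show "- cos (2 * pi * t) = \<bar>cos (2 * pi * t)\<bar>" if "t \<in> {1/4..3/4}" for t
    proof -
      have "2 * pi * (1/4) \<le> 2 * pi * t" "2 * pi * t \<le> 2 * pi * (3/4)" using that by (intro mult_left_mono; auto)+
      then have "cos (2 * pi * t - pi) \<ge> 0" by (intro cos_ge_zero) linarith+
      then show ?thesis by (simp add: cos_diff)
    qed
  qed
  have 3: "((\<lambda>t. \<bar>cos (2 * pi * t)\<bar>) has_integral 1 / (2 * pi)) {3/4..1}"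
  proof (rule has_integral_eq)
    show "((\<lambda>t. cos (2 * pi * t)) has_integral 1 / (2 * pi)) {3/4..1}"
      using I[of "3/4" 1] s3 by (simp add: field_simps)
    show "cos (2 * pi * t) = \<bar>cos (2 * pi * t)\<bar>" if "t \<in> {3/4..1}" for t
    proof -
      have "2 * pi * (3/4) \<le> 2 * pi * t" "2 * pi * t \<le> 2 * pi * 1" using that by (intro mult_left_mono; auto)+
      then have "cos (2 * pi * t - 2 * pi) \<ge> 0" by (intro cos_ge_zero) linarith+
      then show ?thesis by (simp add: cos_diff)
    qed
  qed
  have "((\<lambda>t. \<bar>cos (2 * pi * t)\<bar>) has_integral (1 / (2 * pi) + 2 / (2 * pi)) + 1 / (2 * pi)) {0..1}"
    by (rule has_integral_combine[OF _ _ has_integral_combine[OF _ _ 1 2] 3]) auto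
  then have "((\<lambda>t. \<bar>cos (2 * pi * t)\<bar>) has_integral 2 / pi) {0..1}"
    by (simp add: field_simps)
  then have "((\<lambda>t. complex_of_real \<bar>cos (2 * pi * t)\<bar>) has_integral of_real (2 / pi)) {0..1}"
    by (rule has_integral_of_real)
  from integral_unique[OF this] show ?thesis by (simp add: circle_mean_def)
qed

text \<open>On the unit circle 1 / w^m is the conjugate of w^m, so for real g the modulus of the coefficient is
the mean of g Re (u w^m) for some unimodular u. This is at most M times the mean of |Re (u w^m)|,
which equals the mean of |Re w|, namely 2 / pi. This is the source of
the constant 4 / pi in the theorem.\<close>
lemma coeff_bound_real_interval: "coeff_bound (of_real ` {-M..M}) (2 * M / pi)"
  unfolding coeff_bound_def
proof (intro allI impI)
  fix g :: "complex \<Rightarrow> complex" and m :: nat and r :: real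
  assume r: "r > 0" and m: "m > 0" and g: "continuous_on (sphere 0 r) g" "g ` sphere 0 r \<subseteq> of_real ` {-M..M}"
  define g' where "g' w = g (of_real r * w)" for w
  have in_sphere: "of_real r * w \<in> sphere 0 r" if "w \<in> sphere 0 1" for w :: complex
    using that r by (simp add: norm_mult)
  have cg': "continuous_on (sphere 0 1) g'" unfolding g'_def
    by (rule continuous_on_compose2[OF g(1)]) (use in_sphere in \<open>auto intro!: continuous_intros\<close>)
  define I where "I = circle_mean (\<lambda>w. g' w / w ^ m) 0 1"
  have cI: "continuous_on (sphere 0 1) (\<lambda>w. g' w / w ^ m)" by (auto intro!: continuous_intros cg')
  have "circle_mean (\<lambda>w. g w / w ^ m) 0 r = circle_mean (\<lambda>w. (1 / of_real r ^ m) * (g' w / w ^ m)) 0 1"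
    unfolding circle_mean_def g'_def by (simp add: power_mult_distrib)
  then have gI: "circle_mean (\<lambda>w. g w / w ^ m) 0 r = I / of_real r ^ m"
    by (simp only: circle_mean_cmult I_def) simp
  obtain u where u: "cmod u = 1" "cnj u * I = of_real (cmod I)"
  proof (cases "I = 0")
    case False
    have "cnj (sgn I) * I = (I * cnj I) / of_real (cmod I)"
      by (simp add: sgn_div_norm scaleR_conv_of_real field_simps)
    also have "\<dots> = of_real (cmod I)"
      using False by (simp add: complex_norm_square[symmetric] power2_eq_square)
    finally show ?thesis using that[of "sgn I"] False by (simp add: norm_sgn)
  qed (use that[of 1] in auto)
  have "continuous_on (sphere 0 1) (\<lambda>w. cnj u * (g' w / w ^ m))" by (intro continuous_intros cI)
  from circle_mean_integrable[OF this] 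
  have F: "(\<lambda>t. cnj u * (g' (cis (2 * pi * t)) / cis (2 * pi * t) ^ m)) integrable_on {0..1}" by simp
  have "cmod I = Re (cnj u * I)" by (simp add: u)
  also have "\<dots> = Re (circle_mean (\<lambda>w. cnj u * (g' w / w ^ m)) 0 1)"
    by (simp only: circle_mean_cmult I_def)
  also have "\<dots> = integral {0..1} (\<lambda>t. Re (cnj u * (g' (cis (2 * pi * t)) / cis (2 * pi * t) ^ m)))"
    using integral_linear[OF F bounded_linear_Re] by (simp add: circle_mean_def o_def)
  also have "\<dots> \<le> integral {0..1} (\<lambda>t. M * \<bar>Re (u * cis (2 * pi * t) ^ m)\<bar>)"
  proof (rule integral_le)
    show "(\<lambda>t. Re (cnj u * (g' (cis (2 * pi * t)) / cis (2 * pi * t) ^ m))) integrable_on {0..1}"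
      using integrable_linear[OF F bounded_linear_Re] by (simp add: o_def)
    show "(\<lambda>t. M * \<bar>Re (u * cis (2 * pi * t) ^ m)\<bar>) integrable_on {0..1}"
      by (rule integrable_continuous_real) (auto intro!: continuous_intros)
    fix t :: real
    define w where "w = cis (2 * pi * t)"
    have w: "w \<in> sphere 0 1" "cmod (w ^ m) = 1" by (simp_all add: w_def norm_power)
    have "g' w \<in> of_real ` {-M..M}"
      using subsetD[OF g(2) imageI[OF in_sphere[OF w(1)]]] by (simp only: g'_def)
    then obtain x where "x \<in> {-M..M}" "g' w = of_real x" by blast
    then have x: "g' w = of_real x" "\<bar>x\<bar> \<le> M" by auto
    have "1 / w ^ m = cnj (w ^ m)"
      using w(2) complex_div_cnj[of 1 "w ^ m"] by simp
    then have "Re (cnj u * (g' w / w ^ m)) = x * Re (cnj u * cnj (w ^ m))"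
      by (simp add: x divide_inverse flip: inverse_eq_divide) (simp add: algebra_simps)
    also have "\<dots> \<le> \<bar>x\<bar> * \<bar>Re (cnj u * cnj (w ^ m))\<bar>" by (metis abs_ge_self abs_mult)
    also have "\<dots> \<le> M * \<bar>Re (u * w ^ m)\<bar>"
    proof -
      have "Re (cnj u * cnj (w ^ m)) = Re (u * w ^ m)"
        unfolding complex_cnj_mult[symmetric] by (rule cnj.sel(1))
      then show ?thesis using x(2) by (simp add: mult_right_mono)
    qed
    finally show "Re (cnj u * (g' (cis (2 * pi * t)) / cis (2 * pi * t) ^ m)) \<le> M * \<bar>Re (u * cis (2 * pi * t) ^ m)\<bar>"
      by (simp add: w_def)
  qed
  also have "\<dots> = M * (2 / pi)"
  proof -
    have "integral {0..1} (\<lambda>t. complex_of_real \<bar>Re (u * cis (2 * pi * t) ^ m)\<bar>) = of_real (2 / pi)"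
      using circle_mean_compose_power[of "\<lambda>w. of_real \<bar>Re w\<bar>" u m] u(1) m circle_mean_abs_Re
      by (simp add: circle_mean_def continuous_intros)
    moreover have "(\<lambda>t. \<bar>Re (u * cis (2 * pi * t) ^ m)\<bar>) integrable_on {0..1}"
      by (intro integrable_continuous_real continuous_intros)
    from integral_linear[OF this bounded_linear_of_real[where 'a = complex]]
    have "integral {0..1} (\<lambda>t. complex_of_real \<bar>Re (u * cis (2 * pi * t) ^ m)\<bar>) =
        of_real (integral {0..1} (\<lambda>t. \<bar>Re (u * cis (2 * pi * t) ^ m)\<bar>))"
      by (simp add: o_def)
    ultimately have "integral {0..1} (\<lambda>t. \<bar>Re (u * cis (2 * pi * t) ^ m)\<bar>) = 2 / pi"
      by (metis of_real_eq_iff)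
    then show ?thesis by simp
  qed
  finally have "cmod I \<le> M * (2 / pi)" .
  then have "cmod I / r ^ m \<le> 2 * M / pi / r ^ m" using r by (intro divide_right_mono) (simp_all add: mult.commute)
  then show "cmod (circle_mean (\<lambda>w. g w / w ^ m) 0 r) \<le> 2 * M / pi / r ^ m"
    unfolding gI using r by (simp add: norm_divide norm_power)
qed

section \<open>Separately harmonic functions on the polydisk\<close>

definition upd :: "complex ^ 'n \<Rightarrow> 'n \<Rightarrow> complex \<Rightarrow> complex ^ 'n" where
  "upd z j \<zeta> = (\<chi> i. if i = j then \<zeta> else z $ i)"

lemma upd_nth [simp]: "upd z j \<zeta> $ i = (if i = j then \<zeta> else z $ i)"
  by (simp add: upd_def)

lemma upd_same [simp]: "upd z j (z $ j) = z"
  by (simp add: vec_eq_iff)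

lemma upd_upd [simp]: "upd (upd z j a) j b = upd z j b"
  by (simp add: vec_eq_iff)

lemma upd_commute: "i \<noteq> j \<Longrightarrow> upd (upd z i a) j b = upd (upd z j b) i a"
  by (auto simp: vec_eq_iff)

lemma upd_add_axis: "upd z j \<zeta> + t *\<^sub>R axis j c = upd z j (\<zeta> + t * c)"
  by (auto simp: vec_eq_iff axis_def) (simp add: scaleR_conv_of_real)

lemma upd_add_smult_axis: "upd z j \<zeta> + t *s axis j 1 = upd z j (\<zeta> + t)"
  by (auto simp: vec_eq_iff axis_def)

lemma upd_in_polydisk: "z \<in> polydisk \<Longrightarrow> \<zeta> \<in> ball 0 1 \<Longrightarrow> upd z j \<zeta> \<in> polydisk"
  by (simp add: polydisk_def)

lemma polydisk_nth: "z \<in> polydisk \<Longrightarrow> cmod (z $ j) < 1"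
  by (simp add: polydisk_def)

lemma continuous_on_upd [continuous_intros]:
  assumes "continuous_on A f" "continuous_on A g"
  shows "continuous_on A (\<lambda>x. upd (f x) j (g x))"
proof -
  have "continuous_on A (\<lambda>x. \<chi> i. if i = j then g x else f x $ i)"
  proof (rule continuous_on_vec_lambda)
    show "continuous_on A (\<lambda>x. if i = j then g x else f x $ i)" for i
      using assms by (cases "i = j") (auto intro!: continuous_intros)
  qed
  then show ?thesis by (simp add: upd_def)
qed

lemma open_polydisk: "open (polydisk :: (complex ^ 'n) set)"
proof -
  have "polydisk = (\<Inter>j. {z :: complex ^ 'n. z $ j \<in> ball 0 1})" by (auto simp: polydisk_def)
  also have "open \<dots>"
  proof (intro open_INT ballI finite)
    show "open {z :: complex ^ 'n. z $ j \<in> ball 0 1}" for j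
      by (rule open_vimage_vec_nth[of "ball 0 1" j, unfolded vimage_def]) simp
  qed
  finally show ?thesis .
qed

text \<open>Harmonicity in each of the variables j \<in> S, on every coordinate disc, expressed by Poisson's formula
rather than by derivatives: an integral identity survives integration over the other variables.\<close>
definition sep_harmonic :: "'n set \<Rightarrow> (complex ^ 'n \<Rightarrow> complex) \<Rightarrow> bool" where
  "sep_harmonic S F \<longleftrightarrow> continuous_on polydisk F \<and>
     (\<forall>j\<in>S. \<forall>z\<in>polydisk. \<forall>r. cmod (z $ j) < r \<longrightarrow> r < 1 \<longrightarrow>
        F z = circle_mean (\<lambda>w. F (upd z j w) * poisson_kernel w (z $ j)) 0 r)"

lemma continuous_on_slice:
  assumes "continuous_on polydisk F" "z \<in> polydisk" "A \<subseteq> ball 0 1"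
  shows "continuous_on A (\<lambda>\<zeta>. F (upd z j \<zeta>))"
  by (rule continuous_on_compose2[OF assms(1)])
     (use assms(3) in \<open>auto intro!: continuous_intros upd_in_polydisk[OF assms(2)] simp del: mem_ball\<close>)

lemma boundary_dist_pos:
  assumes "open \<Omega>" "z \<in> \<Omega>"
  shows "boundary_dist \<Omega> z > 0"
proof -
  obtain e where e: "e > 0" "ball z e \<subseteq> \<Omega>" using assms open_contains_ball by blast
  have "ereal e \<le> boundary_dist \<Omega> z"
    unfolding boundary_dist_def
  proof (rule INF_greatest)
    fix w assume "w \<in> frontier \<Omega>"
    then have "w \<notin> \<Omega>" using assms(1) by (simp add: frontier_def interior_open)
    then have "w \<notin> ball z e" using e by auto
    then show "ereal e \<le> ereal (dist z w)" by simp
  qed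
  then show ?thesis using e(1) by (metis ereal_less(2) less_le_trans)
qed

text \<open>The definition of pluriharmonicity controls a line only near its base point, within the distance to
the boundary. As harmonicity is a local property, each point x of a coordinate disc is treated with
upd z j x as the base point.\<close>
lemma pluriharmonic_slice_harmonic_at:
  assumes f: "pluriharmonic_on f polydisk" and z: "z \<in> polydisk" and x: "x \<in> ball 0 1"
  shows "harmonic_at (\<lambda>\<zeta>. f (upd z j \<zeta>)) x"
proof -
  define z' where "z' = upd z j x"
  have z': "z' \<in> polydisk" using upd_in_polydisk[OF z x] by (simp add: z'_def)
  define U where "U = {\<zeta>. ereal (cmod \<zeta>) < boundary_dist polydisk z'}"
  have "harmonic_on (\<lambda>\<zeta>. f (z' + \<zeta> *s axis j 1)) U"
    using f z' unfolding pluriharmonic_on_def U_def by (simp add: norm_axis_1)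
  moreover have "open U" unfolding U_def by (intro open_Collect_less continuous_intros)
  moreover have "0 \<in> U" using boundary_dist_pos[OF open_polydisk z'] by (simp add: U_def zero_ereal_def)
  ultimately have "harmonic_at (\<lambda>\<zeta>. f (z' + \<zeta> *s axis j 1)) 0" by (rule harmonic_on_imp_harmonic_at)
  then show ?thesis
    unfolding z'_def upd_add_smult_axis by (simp only: harmonic_at_translate[of "\<lambda>\<zeta>. f (upd z j \<zeta>)"])
qed

lemma pluriharmonic_imp_sep_harmonic:
  assumes f: "pluriharmonic_on f polydisk"
  shows "sep_harmonic S f"
  unfolding sep_harmonic_def
proof (intro conjI ballI allI impI)
  show cont: "continuous_on polydisk f" using f by (simp add: pluriharmonic_on_def)
  fix j r and z :: "complex ^ 'a" assume z: "z \<in> polydisk" and r: "cmod (z $ j) < r" "r < 1"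
  have "f (upd z j (z $ j)) = circle_mean (\<lambda>w. f (upd z j w) * poisson_kernel w (z $ j)) 0 r"
  proof (rule harmonic_imp_poisson)
    show "continuous_on (cball 0 r) (\<lambda>w. f (upd z j w))"
      by (rule continuous_on_slice[OF cont z]) (use r in auto)
    show "harmonic_at (\<lambda>w. f (upd z j w)) x" if "x \<in> ball 0 r" for x
      using pluriharmonic_slice_harmonic_at[OF f z] that r by simp
  qed (use r in auto)
  then show "f z = circle_mean (\<lambda>w. f (upd z j w) * poisson_kernel w (z $ j)) 0 r" by simp
qed

lemma sep_harmonic_lincomb:
  assumes F: "sep_harmonic S F" and G: "sep_harmonic S G"
  shows "sep_harmonic S (\<lambda>z. c * F z + d * cnj (G z))"
  unfolding sep_harmonic_def
proof (intro conjI ballI allI impI)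
  have cF: "continuous_on polydisk F" and cG: "continuous_on polydisk G"
    using F G by (auto simp: sep_harmonic_def)
  then show "continuous_on polydisk (\<lambda>z. c * F z + d * cnj (G z))" by (intro continuous_intros)
  fix j r and z :: "complex ^ 'a" assume j: "j \<in> S" and z: "z \<in> polydisk" and r: "cmod (z $ j) < r" "r < 1"
  have r0: "r \<ge> 0" using r norm_ge_zero[of "z $ j"] by linarith
  have sub: "sphere 0 r \<subseteq> ball (0::complex) 1" using r by auto
  note c = continuous_on_slice[OF cF z sub] continuous_on_slice[OF cG z sub]
    continuous_on_poisson_kernel[of "z $ j" "sphere 0 r"]
  let ?P = "\<lambda>w. poisson_kernel w (z $ j)"
  have "circle_mean (\<lambda>w. (c * F (upd z j w) + d * cnj (G (upd z j w))) * ?P w) 0 r =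
        circle_mean (\<lambda>w. c * (F (upd z j w) * ?P w) + d * cnj (G (upd z j w) * ?P w)) 0 r"
    by (simp add: algebra_simps cnj_poisson_kernel)
  also have "\<dots> = c * circle_mean (\<lambda>w. F (upd z j w) * ?P w) 0 r + d * cnj (circle_mean (\<lambda>w. G (upd z j w) * ?P w) 0 r)"
    unfolding circle_mean_cnj[symmetric] circle_mean_cmult[symmetric]
    by (rule circle_mean_add) (use r r0 in \<open>auto intro!: continuous_intros c\<close>)
  finally show "c * F z + d * cnj (G z) = circle_mean (\<lambda>w. (c * F (upd z j w) + d * cnj (G (upd z j w))) * ?P w) 0 r"
    using F G j z r by (simp add: sep_harmonic_def)
qed

lemma sep_harmonic_cnj: "sep_harmonic S F \<Longrightarrow> sep_harmonic S (\<lambda>z. cnj (F z))"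
  using sep_harmonic_lincomb[of S F F 0 1] by simp

lemma sep_harmonic_slice:
  assumes F: "sep_harmonic S F" and j: "j \<in> S" and z: "z \<in> polydisk" and r: "r < 1"
  obtains H K where "H holomorphic_on ball 0 r" "K holomorphic_on ball 0 r"
    "\<And>\<zeta>. \<zeta> \<in> ball 0 r \<Longrightarrow> F (upd z j \<zeta>) = H \<zeta> + cnj (K \<zeta>)"
proof (rule poisson_imp_harmonic_decomposition)
  have cF: "continuous_on polydisk F" using F by (simp add: sep_harmonic_def)
  show "continuous_on (sphere 0 r) (\<lambda>\<zeta>. F (upd z j \<zeta>))"
    by (rule continuous_on_slice[OF cF z]) (use r in auto)
  fix \<zeta> :: complex assume \<zeta>: "\<zeta> \<in> ball 0 r"
  then have "upd z j \<zeta> \<in> polydisk" using z r by (intro upd_in_polydisk) auto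
  then show "F (upd z j \<zeta>) = circle_mean (\<lambda>w. F (upd z j w) * poisson_kernel w \<zeta>) 0 r"
    using F j \<zeta> r unfolding sep_harmonic_def by fastforce
qed (use that in auto)

section \<open>Wirtinger derivatives in one variable\<close>

lemma dir_deriv_slice:
  assumes A: "A holomorphic_on U" and B: "B holomorphic_on U" and U: "open U"
    and F: "\<And>\<zeta>. \<zeta> \<in> U \<Longrightarrow> F (upd z j \<zeta>) = A \<zeta> + cnj (B \<zeta>)" and \<zeta>: "\<zeta> \<in> U"
  shows "dir_deriv (axis j c) F (upd z j \<zeta>) = c * deriv A \<zeta> + cnj (c * deriv B \<zeta>)"
proof -
  have lin: "((\<lambda>t. \<zeta> + of_real t * c) has_vector_derivative c) (at 0)"
    by (auto intro!: derivative_eq_intros simp: has_vector_derivative_def scaleR_conv_of_real)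
  have chain: "((\<lambda>t. L (\<zeta> + of_real t * c)) has_vector_derivative c * deriv L \<zeta>) (at 0)"
    if "L holomorphic_on U" for L
    using field_vector_diff_chain_at[OF lin, of L "deriv L \<zeta>"] holomorphic_derivI[OF that U \<zeta>]
    by (simp add: o_def)
  have d: "((\<lambda>t. A (\<zeta> + of_real t * c) + cnj (B (\<zeta> + of_real t * c)))
      has_vector_derivative c * deriv A \<zeta> + cnj (c * deriv B \<zeta>)) (at 0)"
    by (intro has_vector_derivative_add bounded_linear.has_vector_derivative[OF bounded_linear_cnj] chain A B)
  have "open {t::real. \<zeta> + of_real t * c \<in> U}"
    using open_vimage[OF U, of "\<lambda>t::real. \<zeta> + of_real t * c"] by (simp add: vimage_def continuous_intros)
  then have "((\<lambda>t. F (upd z j \<zeta> + t *\<^sub>R axis j c)) has_vector_derivative c * deriv A \<zeta> + cnj (c * deriv B \<zeta>)) (at 0)"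
    by (rule has_vector_derivative_transform_within_open[OF d]) (use \<zeta> F in \<open>auto simp: upd_add_axis\<close>)
  then show ?thesis unfolding dir_deriv_def by (rule vector_derivative_at)
qed

text \<open>On the slice A + cnj B, the derivative along the direction c is c A' + cnj (c B'). The combination
of c = 1 and c = \<i> that defines the Wirtinger derivative isolates A', the conjugate combination isolates cnj B'.\<close>
lemma wirtinger_slice:
  assumes "A holomorphic_on U" "B holomorphic_on U" "open U"
    and "\<And>\<zeta>. \<zeta> \<in> U \<Longrightarrow> F (upd z j \<zeta>) = A \<zeta> + cnj (B \<zeta>)" and "\<zeta> \<in> U"
  shows "wirtinger j F (upd z j \<zeta>) = deriv A \<zeta>"
    and "wirtinger_bar j F (upd z j \<zeta>) = cnj (deriv B \<zeta>)"
proof -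
  have d1: "dir_deriv (axis j 1) F (upd z j \<zeta>) = deriv A \<zeta> + cnj (deriv B \<zeta>)"
    using dir_deriv_slice[OF assms, of 1] by simp
  have di: "dir_deriv (axis j \<i>) F (upd z j \<zeta>) = \<i> * deriv A \<zeta> - \<i> * cnj (deriv B \<zeta>)"
    using dir_deriv_slice[OF assms, of \<i>] by simp
  show "wirtinger j F (upd z j \<zeta>) = deriv A \<zeta>"
    and "wirtinger_bar j F (upd z j \<zeta>) = cnj (deriv B \<zeta>)"
    unfolding wirtinger_def wirtinger_bar_def d1 di by (simp_all add: algebra_simps)
qed

text \<open>The first derivative annihilates the antiholomorphic part, so from then on the slices are
holomorphic. This is why a positive order of differentiation is required.\<close>
lemma wirtinger_power_slice:
  assumes A: "A holomorphic_on U" and B: "B holomorphic_on U" and U: "open U"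
    and F: "\<And>\<zeta>. \<zeta> \<in> U \<Longrightarrow> F (upd z j \<zeta>) = A \<zeta> + cnj (B \<zeta>)" and \<zeta>: "\<zeta> \<in> U"
  shows "(wirtinger j ^^ Suc k) F (upd z j \<zeta>) = (deriv ^^ Suc k) A \<zeta>"
    and "(wirtinger_bar j ^^ Suc k) F (upd z j \<zeta>) = cnj ((deriv ^^ Suc k) B \<zeta>)"
proof -
  have zero: "(\<lambda>_. 0) holomorphic_on U" by simp
  have "\<forall>\<zeta>\<in>U. (wirtinger j ^^ Suc k) F (upd z j \<zeta>) = (deriv ^^ Suc k) A \<zeta>"
  proof (induction k)
    case (Suc k)
    have h: "(deriv ^^ Suc k) A holomorphic_on U" by (rule holomorphic_higher_deriv[OF A U])
    show ?case
      using wirtinger_slice(1)[OF h zero U, of "(wirtinger j ^^ Suc k) F" z j] Suc by simp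
  qed (use wirtinger_slice(1)[OF A B U F] in simp)
  then show "(wirtinger j ^^ Suc k) F (upd z j \<zeta>) = (deriv ^^ Suc k) A \<zeta>" using \<zeta> by blast
  have "\<forall>\<zeta>\<in>U. (wirtinger_bar j ^^ Suc k) F (upd z j \<zeta>) = cnj ((deriv ^^ Suc k) B \<zeta>)"
  proof (induction k)
    case (Suc k)
    have h: "(deriv ^^ Suc k) B holomorphic_on U" by (rule holomorphic_higher_deriv[OF B U])
    show ?case
      using wirtinger_slice(2)[OF zero h U, of "(wirtinger_bar j ^^ Suc k) F" z j] Suc by simp
  qed (use wirtinger_slice(2)[OF A B U F] in simp)
  then show "(wirtinger_bar j ^^ Suc k) F (upd z j \<zeta>) = cnj ((deriv ^^ Suc k) B \<zeta>)" using \<zeta> by blast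
qed

lemma radius_between:
  fixes z :: "complex ^ 'n"
  assumes "z \<in> polydisk"
  obtains r where "cmod (z $ j) < r" "r < 1"
  using polydisk_nth[OF assms] dense by blast

lemma wirtinger_power_lincomb:
  assumes F: "sep_harmonic S F" and G: "sep_harmonic S G" and j: "j \<in> S"
    and E: "\<And>z. z \<in> polydisk \<Longrightarrow> E z = c * F z + d * G z" and z: "z \<in> polydisk"
  shows "(wirtinger j ^^ Suc k) E z = c * (wirtinger j ^^ Suc k) F z + d * (wirtinger j ^^ Suc k) G z"
proof -
  obtain r where r: "cmod (z $ j) < r" "r < 1" using radius_between[OF z] by blast
  then have zr: "z $ j \<in> ball 0 r" by simp
  obtain H K where HK: "H holomorphic_on ball 0 r" "K holomorphic_on ball 0 r"
    "\<And>\<zeta>. \<zeta> \<in> ball 0 r \<Longrightarrow> F (upd z j \<zeta>) = H \<zeta> + cnj (K \<zeta>)" using sep_harmonic_slice[OF F j z r(2)] by blast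
  obtain H' K' where HK': "H' holomorphic_on ball 0 r" "K' holomorphic_on ball 0 r"
    "\<And>\<zeta>. \<zeta> \<in> ball 0 r \<Longrightarrow> G (upd z j \<zeta>) = H' \<zeta> + cnj (K' \<zeta>)" using sep_harmonic_slice[OF G j z r(2)] by blast
  have E': "E (upd z j \<zeta>) = (c * H \<zeta> + d * H' \<zeta>) + cnj (cnj c * K \<zeta> + cnj d * K' \<zeta>)" if "\<zeta> \<in> ball 0 r" for \<zeta>
    using HK(3)[OF that] HK'(3)[OF that] E[OF upd_in_polydisk[OF z]] that r by (simp add: algebra_simps)
  have hol: "(\<lambda>\<zeta>. c * H \<zeta> + d * H' \<zeta>) holomorphic_on ball 0 r"
    "(\<lambda>\<zeta>. cnj c * K \<zeta> + cnj d * K' \<zeta>) holomorphic_on ball 0 r"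
    using HK HK' by (auto intro!: holomorphic_intros)
  have "(wirtinger j ^^ Suc k) E (upd z j (z $ j)) = (deriv ^^ Suc k) (\<lambda>\<zeta>. c * H \<zeta> + d * H' \<zeta>) (z $ j)"
    by (rule wirtinger_power_slice(1)[OF hol _ E' zr]) auto
  also have "\<dots> = (deriv ^^ Suc k) (\<lambda>\<zeta>. c * H \<zeta>) (z $ j) + (deriv ^^ Suc k) (\<lambda>\<zeta>. d * H' \<zeta>) (z $ j)"
    by (rule higher_deriv_add[OF _ _ open_ball zr]) (use HK HK' in \<open>auto intro!: holomorphic_intros\<close>)
  also have "\<dots> = c * (deriv ^^ Suc k) H (z $ j) + d * (deriv ^^ Suc k) H' (z $ j)"
    using higher_deriv_cmult[OF HK(1) zr open_ball, of "Suc k"] higher_deriv_cmult[OF HK'(1) zr open_ball, of "Suc k"] by simp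
  also have "(deriv ^^ Suc k) H (z $ j) = (wirtinger j ^^ Suc k) F (upd z j (z $ j))"
    by (rule wirtinger_power_slice(1)[OF HK(1,2) open_ball HK(3) zr, symmetric])
  also have "(deriv ^^ Suc k) H' (z $ j) = (wirtinger j ^^ Suc k) G (upd z j (z $ j))"
    by (rule wirtinger_power_slice(1)[OF HK'(1,2) open_ball HK'(3) zr, symmetric])
  finally show ?thesis by (simp only: upd_same)
qed

lemma wirtinger_bar_power_cnj:
  assumes F: "sep_harmonic S F" and j: "j \<in> S"
    and E: "\<And>z. z \<in> polydisk \<Longrightarrow> E z = cnj (F z)" and z: "z \<in> polydisk"
  shows "(wirtinger_bar j ^^ Suc k) E z = cnj ((wirtinger j ^^ Suc k) F z)"
proof -
  obtain r where r: "cmod (z $ j) < r" "r < 1" using radius_between[OF z] by blast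
  then have zr: "z $ j \<in> ball 0 r" by simp
  obtain H K where HK: "H holomorphic_on ball 0 r" "K holomorphic_on ball 0 r"
    "\<And>\<zeta>. \<zeta> \<in> ball 0 r \<Longrightarrow> F (upd z j \<zeta>) = H \<zeta> + cnj (K \<zeta>)" using sep_harmonic_slice[OF F j z r(2)] by blast
  have E': "E (upd z j \<zeta>) = K \<zeta> + cnj (H \<zeta>)" if "\<zeta> \<in> ball 0 r" for \<zeta>
    using HK(3)[OF that] E[OF upd_in_polydisk[OF z]] that r by simp
  show ?thesis
    using wirtinger_power_slice(2)[OF HK(2,1) open_ball E' zr, of k]
      wirtinger_power_slice(1)[OF HK(1,2) open_ball HK(3) zr, of k] by (simp only: upd_same)
qed

text \<open>A representation that refers to the values of F only: it yields continuity in all variables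
jointly and allows other variables to be averaged under the integral sign.\<close>
lemma wirtinger_power_circle_mean:
  fixes z :: "complex ^ 'n"
  assumes F: "sep_harmonic S F" and j: "j \<in> S" and z: "z \<in> polydisk" and \<rho>: "\<rho> > 0" "cmod (z $ j) + \<rho> < 1"
  shows "(wirtinger j ^^ Suc k) F z =
     fact (Suc k) * circle_mean (\<lambda>w. F (upd z j w) / (w - z $ j) ^ Suc k) (z $ j) \<rho>"
proof -
  obtain r where r: "cmod (z $ j) + \<rho> < r" "r < 1" using dense[OF \<rho>(2)] by blast
  have zr: "z $ j \<in> ball 0 r" using r \<rho> by simp
  have sub: "cball (z $ j) \<rho> \<subseteq> ball 0 r"
  proof
    fix w assume "w \<in> cball (z $ j) \<rho>"
    then have "cmod (w - z $ j) \<le> \<rho>" by (simp add: dist_norm norm_minus_commute)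
    then have "cmod w \<le> cmod (z $ j) + \<rho>" using norm_triangle_sub[of w "z $ j"] by linarith
    then show "w \<in> ball 0 r" using r by simp
  qed
  obtain H K where HK: "H holomorphic_on ball 0 r" "K holomorphic_on ball 0 r"
    "\<And>\<zeta>. \<zeta> \<in> ball 0 r \<Longrightarrow> F (upd z j \<zeta>) = H \<zeta> + cnj (K \<zeta>)" using sep_harmonic_slice[OF F j z r(2)] by blast
  have "circle_mean (\<lambda>w. F (upd z j w) / (w - z $ j) ^ Suc k) (z $ j) \<rho> = (deriv ^^ Suc k) H (z $ j) / fact (Suc k)"
    by (rule harmonic_coeff_formula[OF HK sub \<rho>(1)]) auto
  moreover have "(wirtinger j ^^ Suc k) F (upd z j (z $ j)) = (deriv ^^ Suc k) H (z $ j)"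
    by (rule wirtinger_power_slice(1)[OF HK(1,2) open_ball HK(3) zr])
  ultimately show ?thesis by (simp del: fact_Suc funpow.simps)
qed

lemma circle_mean_swap:
  assumes "continuous_on (sphere a r \<times> sphere b s) (\<lambda>(x, y). \<Phi> x y)" "r \<ge> 0" "s \<ge> 0"
  shows "circle_mean (\<lambda>x. circle_mean (\<lambda>y. \<Phi> x y) b s) a r = circle_mean (\<lambda>y. circle_mean (\<lambda>x. \<Phi> x y) a r) b s"
proof -
  have "continuous_on (cbox (0, 0) (1::real, 1::real))
     (\<lambda>p. case (a + of_real r * cis (2 * pi * fst p), b + of_real s * cis (2 * pi * snd p)) of (x, y) \<Rightarrow> \<Phi> x y)"
    by (rule continuous_on_compose2[OF assms(1)])
       (use assms(2,3) circle_point_in_sphere in \<open>auto intro!: continuous_intros simp del: mem_sphere\<close>)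
  then show ?thesis
    unfolding circle_mean_def
    using integral_swap_continuous[of 0 0 1 1 "\<lambda>t u. \<Phi> (a + of_real r * cis (2 * pi * t)) (b + of_real s * cis (2 * pi * u))"]
    by (simp add: case_prod_unfold cbox_interval)
qed

lemma continuous_on_wirtinger_power:
  assumes F: "sep_harmonic S F" and j: "j \<in> S"
  shows "continuous_on polydisk ((wirtinger j ^^ Suc k) F)"
proof (rule continuous_at_imp_continuous_on, rule ballI)
  fix z0 :: "complex ^ 'a" assume z0: "z0 \<in> polydisk"
  have cF: "continuous_on polydisk F" using F by (simp add: sep_harmonic_def)
  \<comment> \<open>one radius that serves a whole neighbourhood U of z0, so that continuity under the integral applies\<close>
  define \<rho> where "\<rho> = (1 - cmod (z0 $ j)) / 2"
  have \<rho>: "\<rho> > 0" "cmod (z0 $ j) + \<rho> < 1" using polydisk_nth[OF z0, of j] by (auto simp: \<rho>_def field_simps)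
  define U where "U = polydisk \<inter> {z. cmod (z $ j) + \<rho> < 1}"
  have "open U" unfolding U_def
    by (intro open_Int open_polydisk open_Collect_less continuous_intros)
  moreover have "z0 \<in> U" using z0 \<rho> by (simp add: U_def)
  moreover have "continuous_on U ((wirtinger j ^^ Suc k) F)"
  proof (rule continuous_on_eq)
    show "fact (Suc k) * circle_mean (\<lambda>w. F (upd z j w) / (w - z $ j) ^ Suc k) (z $ j) \<rho> = (wirtinger j ^^ Suc k) F z"
      if "z \<in> U" for z
      using wirtinger_power_circle_mean[OF F j _ \<rho>(1), of z k] that by (simp add: U_def)
    have "continuous_on (U \<times> cbox 0 (1::real))
       (\<lambda>(z, t). F (upd z j (z $ j + of_real \<rho> * cis (2 * pi * t))) / (z $ j + of_real \<rho> * cis (2 * pi * t) - z $ j) ^ Suc k)"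
      unfolding case_prod_unfold
    proof (rule continuous_on_divide)
      show "continuous_on (U \<times> cbox 0 (1::real)) (\<lambda>p. F (upd (fst p) j (fst p $ j + of_real \<rho> * cis (2 * pi * snd p))))"
      proof (rule continuous_on_compose2[OF cF])
        show "continuous_on (U \<times> cbox 0 (1::real)) (\<lambda>p. upd (fst p) j (fst p $ j + of_real \<rho> * cis (2 * pi * snd p)))"
          by (intro continuous_intros)
        show "(\<lambda>p. upd (fst p) j (fst p $ j + of_real \<rho> * cis (2 * pi * snd p))) ` (U \<times> cbox 0 (1::real)) \<subseteq> polydisk"
        proof clarify
          fix z and t :: real assume "z \<in> U"
          then have "z \<in> polydisk" "cmod (z $ j) + \<rho> < 1" by (auto simp: U_def)
          moreover have "cmod (z $ j + of_real \<rho> * cis (2 * pi * t)) \<le> cmod (z $ j) + \<rho>"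
            using norm_triangle_ineq[of "z $ j" "of_real \<rho> * cis (2 * pi * t)"] \<rho> by (simp add: norm_mult)
          ultimately show "upd (fst (z, t)) j (fst (z, t) $ j + of_real \<rho> * cis (2 * pi * snd (z, t))) \<in> polydisk"
            by (intro upd_in_polydisk) auto
        qed
      qed
    qed (use \<rho> in \<open>auto intro!: continuous_intros\<close>)
    from integral_continuous_on_param[OF this]
    show "continuous_on U (\<lambda>z. fact (Suc k) * circle_mean (\<lambda>w. F (upd z j w) / (w - z $ j) ^ Suc k) (z $ j) \<rho>)"
      unfolding circle_mean_def by (intro continuous_on_mult continuous_on_const) (simp add: cbox_interval)
  qed
  ultimately show "isCont ((wirtinger j ^^ Suc k) F) z0"
    using continuous_on_eq_continuous_at by blast
qed

text \<open>For i \<noteq> j, insert Poisson's formula in the variable i into the integral representation of the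
derivative in the variable j, and interchange the two integrals.\<close>
lemma sep_harmonic_wirtinger_power:
  assumes F: "sep_harmonic S F" and j: "j \<in> S"
  shows "sep_harmonic (S - {j}) ((wirtinger j ^^ Suc k) F)"
  unfolding sep_harmonic_def
proof (intro conjI ballI allI impI)
  show "continuous_on polydisk ((wirtinger j ^^ Suc k) F)" by (rule continuous_on_wirtinger_power[OF F j])
  have cF: "continuous_on polydisk F" using F by (simp add: sep_harmonic_def)
  fix i r and z :: "complex ^ 'a" assume i: "i \<in> S - {j}" and z: "z \<in> polydisk" and r: "cmod (z $ i) < r" "r < 1"
  \<comment> \<open>the same radius serves all points upd z i y, because they share the coordinate j with z\<close>
  define \<rho> where "\<rho> = (1 - cmod (z $ j)) / 2"
  have \<rho>: "\<rho> > 0" "cmod (z $ j) + \<rho> < 1" using polydisk_nth[OF z, of j] by (auto simp: \<rho>_def field_simps)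
  have r0: "r \<ge> 0" using r norm_ge_zero[of "z $ i"] by linarith
  have ij: "i \<in> S" "i \<noteq> j" using i by auto
  have x1: "x \<in> ball 0 1" if "x \<in> sphere (z $ j) \<rho>" for x
  proof -
    have "cmod (x - z $ j) = \<rho>" using that by (simp add: dist_norm norm_minus_commute)
    then show ?thesis using norm_triangle_sub[of x "z $ j"] \<rho> by simp
  qed
  have y1: "y \<in> ball 0 1" if "y \<in> sphere 0 r" for y :: complex using that r by simp
  let ?P = "\<lambda>w. poisson_kernel w (z $ i)"
  let ?\<Phi> = "\<lambda>x y. F (upd (upd z j x) i y) * ?P y / (x - z $ j) ^ Suc k"
  have "circle_mean (\<lambda>x. F (upd z j x) / (x - z $ j) ^ Suc k) (z $ j) \<rho> =
        circle_mean (\<lambda>x. circle_mean (\<lambda>y. ?\<Phi> x y) 0 r) (z $ j) \<rho>"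
  proof (rule circle_mean_cong)
    fix x assume "x \<in> sphere (z $ j) \<rho>"
    then have "upd z j x \<in> polydisk" using upd_in_polydisk[OF z x1] by blast
    then have "F (upd z j x) = circle_mean (\<lambda>w. F (upd (upd z j x) i w) * poisson_kernel w (upd z j x $ i)) 0 r"
      using F ij r unfolding sep_harmonic_def by simp
    then have "F (upd z j x) / (x - z $ j) ^ Suc k =
        inverse ((x - z $ j) ^ Suc k) * circle_mean (\<lambda>w. F (upd (upd z j x) i w) * ?P w) 0 r"
      using ij by (simp add: field_simps)
    also have "\<dots> = circle_mean (\<lambda>y. ?\<Phi> x y) 0 r"
      unfolding circle_mean_cmult[symmetric] by (simp add: divide_inverse mult_ac)
    finally show "F (upd z j x) / (x - z $ j) ^ Suc k = circle_mean (\<lambda>y. ?\<Phi> x y) 0 r" .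
  qed (use \<rho> in auto)
  also have "\<dots> = circle_mean (\<lambda>y. circle_mean (\<lambda>x. ?\<Phi> x y) (z $ j) \<rho>) 0 r"
  proof (rule circle_mean_swap)
    show "continuous_on (sphere (z $ j) \<rho> \<times> sphere 0 r) (\<lambda>(x, y). ?\<Phi> x y)"
      unfolding case_prod_unfold
    proof (rule continuous_on_divide)
      have "continuous_on (sphere (z $ j) \<rho> \<times> sphere 0 r) (\<lambda>p. F (upd (upd z j (fst p)) i (snd p)))"
      proof (rule continuous_on_compose2[OF cF])
        show "(\<lambda>p. upd (upd z j (fst p)) i (snd p)) ` (sphere (z $ j) \<rho> \<times> sphere 0 r) \<subseteq> polydisk"
        proof (rule image_subsetI)
          fix p assume "p \<in> sphere (z $ j) \<rho> \<times> sphere (0::complex) r"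
          then have "fst p \<in> sphere (z $ j) \<rho>" "snd p \<in> sphere 0 r" by (simp_all only: mem_Times_iff)
          then show "upd (upd z j (fst p)) i (snd p) \<in> polydisk"
            by (rule upd_in_polydisk[OF upd_in_polydisk[OF z x1] y1])
        qed
      qed (intro continuous_intros)
      moreover have "continuous_on (sphere (z $ j) \<rho> \<times> sphere 0 r) (\<lambda>p. ?P (snd p))"
        by (rule continuous_on_compose2[OF continuous_on_poisson_kernel[of "z $ i" "sphere 0 r"]])
           (use r in \<open>auto intro!: continuous_intros\<close>)
      ultimately show "continuous_on (sphere (z $ j) \<rho> \<times> sphere 0 r) (\<lambda>p. F (upd (upd z j (fst p)) i (snd p)) * ?P (snd p))"
        by (rule continuous_on_mult)
    qed (use \<rho> in \<open>auto intro!: continuous_intros\<close>)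
  qed (use \<rho> r0 in auto)
  also have "\<dots> = circle_mean (\<lambda>y. circle_mean (\<lambda>x. F (upd (upd z i y) j x) / (x - upd z i y $ j) ^ Suc k) (upd z i y $ j) \<rho> * ?P y) 0 r"
  proof (rule circle_mean_cong[OF r0])
    fix y
    have "circle_mean (\<lambda>x. ?\<Phi> x y) (z $ j) \<rho> =
       circle_mean (\<lambda>x. ?P y * (F (upd (upd z i y) j x) / (x - z $ j) ^ Suc k)) (z $ j) \<rho>"
      using upd_commute[OF ij(2)] by (simp add: mult_ac)
    then show "circle_mean (\<lambda>x. ?\<Phi> x y) (z $ j) \<rho> =
       circle_mean (\<lambda>x. F (upd (upd z i y) j x) / (x - upd z i y $ j) ^ Suc k) (upd z i y $ j) \<rho> * ?P y"
      using ij by (simp only: circle_mean_cmult) (simp add: mult.commute)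
  qed
  finally have eq: "fact (Suc k) * circle_mean (\<lambda>x. F (upd z j x) / (x - z $ j) ^ Suc k) (z $ j) \<rho> =
    circle_mean (\<lambda>y. fact (Suc k) * circle_mean (\<lambda>x. F (upd (upd z i y) j x) / (x - upd z i y $ j) ^ Suc k) (upd z i y $ j) \<rho> * ?P y) 0 r"
    by (simp only: circle_mean_cmult mult.assoc)
  show "(wirtinger j ^^ Suc k) F z = circle_mean (\<lambda>y. (wirtinger j ^^ Suc k) F (upd z i y) * ?P y) 0 r"
    unfolding wirtinger_power_circle_mean[OF F j z \<rho>] eq
  proof (rule circle_mean_cong[OF r0])
    fix y :: complex assume "y \<in> sphere 0 r"
    then have "upd z i y \<in> polydisk" using upd_in_polydisk[OF z y1] by blast
    moreover have "cmod (upd z i y $ j) + \<rho> < 1" using ij \<rho> by simp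
    ultimately show "fact (Suc k) * circle_mean (\<lambda>x. F (upd (upd z i y) j x) / (x - upd z i y $ j) ^ Suc k) (upd z i y $ j) \<rho> * ?P y
       = (wirtinger j ^^ Suc k) F (upd z i y) * ?P y"
      using wirtinger_power_circle_mean[OF F j _ \<rho>(1), of "upd z i y" k] by presburger
  qed
qed

text \<open>The contribution of a single variable, with order a of differentiation and modulus s, to the final
bound.\<close>
definition schwarz_pick_factor :: "nat \<Rightarrow> real \<Rightarrow> real" where
  "schwarz_pick_factor a s = fact a * ((1 + s) ^ (a - 1) / (1 - s\<^sup>2) ^ a)"

text \<open>The slice decomposes on each disc of radius r < 1, where the rescaled one-variable bound applies.
The derivative itself does not depend on r, so r may tend to 1.\<close>
lemma wirtinger_power_bound:
  fixes z :: "complex ^ 'n"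
  assumes F: "sep_harmonic S F" and j: "j \<in> S" and V: "coeff_bound V C" and z: "z \<in> polydisk"
    and FV: "\<And>\<zeta>. \<zeta> \<in> ball 0 1 \<Longrightarrow> F (upd z j \<zeta>) \<in> V"
  shows "cmod ((wirtinger j ^^ Suc k) F z) \<le> C * schwarz_pick_factor (Suc k) (cmod (z $ j))"
proof -
  define s where "s = cmod (z $ j)"
  have s: "0 \<le> s" "s < 1" using polydisk_nth[OF z] by (auto simp: s_def)
  have bd: "cmod ((wirtinger j ^^ Suc k) F z) \<le>
     fact (Suc k) * C * (1 + s / r) ^ k / (1 - (s / r)^2) ^ Suc k / r ^ Suc k" if r: "r \<in> {s<..<1}" for r
  proof -
    have r1: "r < 1" and "s < r" using r by auto
    then have r0: "r > 0" and zr: "z $ j \<in> ball 0 r" using s by (linarith, simp add: s_def)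
    obtain H K where HK: "H holomorphic_on ball 0 r" "K holomorphic_on ball 0 r"
      "\<And>\<zeta>. \<zeta> \<in> ball 0 r \<Longrightarrow> F (upd z j \<zeta>) = H \<zeta> + cnj (K \<zeta>)" using sep_harmonic_slice[OF F j z r1] by blast
    have "(\<lambda>\<zeta>. F (upd z j \<zeta>)) ` ball 0 r \<subseteq> V"
    proof (rule image_subsetI)
      fix \<zeta> :: complex assume "\<zeta> \<in> ball 0 r"
      then show "F (upd z j \<zeta>) \<in> V" using r1 by (intro FV) simp
    qed
    from coeff_bound_derivative[OF V r0 HK this zr, of k]
    show ?thesis using wirtinger_power_slice(1)[OF HK(1,2) open_ball HK(3) zr, of k]
      by (simp only: upd_same s_def)
  qed
  have "cmod ((wirtinger j ^^ Suc k) F z) \<le> fact (Suc k) * C * (1 + s) ^ k / (1 - s^2) ^ Suc k"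
  proof (rule tendsto_lowerbound)
    have "1 - (s / 1)^2 \<noteq> 0" using s by (simp add: power2_eq_1_iff)
    then have "((\<lambda>r. fact (Suc k) * C * (1 + s / r) ^ k / (1 - (s / r)^2) ^ Suc k / r ^ Suc k) \<longlongrightarrow>
      fact (Suc k) * C * (1 + s / 1) ^ k / (1 - (s / 1)^2) ^ Suc k / 1 ^ Suc k) (at_left (1::real))"
      by (intro tendsto_intros) auto
    then show "((\<lambda>r. fact (Suc k) * C * (1 + s / r) ^ k / (1 - (s / r)^2) ^ Suc k / r ^ Suc k) \<longlongrightarrow>
      fact (Suc k) * C * (1 + s) ^ k / (1 - s^2) ^ Suc k) (at_left (1::real))" by simp
    show "\<forall>\<^sub>F r in at_left 1. cmod ((wirtinger j ^^ Suc k) F z) \<le>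
        fact (Suc k) * C * (1 + s / r) ^ k / (1 - (s / r)^2) ^ Suc k / r ^ Suc k"
      using eventually_at_left_real[OF s(2)] by (rule eventually_mono) (rule bd)
  qed simp
  also have "\<dots> = C * schwarz_pick_factor (Suc k) s"
    by (simp add: schwarz_pick_factor_def del: fact_Suc power_Suc)
  finally show ?thesis unfolding s_def .
qed

section \<open>Mixed derivatives\<close>

abbreviation deriv_list :: "('n \<Rightarrow> 'f \<Rightarrow> 'f) \<Rightarrow> ('n \<Rightarrow> nat) \<Rightarrow> 'n list \<Rightarrow> 'f \<Rightarrow> 'f" where
  "deriv_list D \<alpha> js \<equiv> foldr (\<lambda>j. D j ^^ \<alpha> j) js"

lemma sep_harmonic_deriv_list:
  assumes "sep_harmonic UNIV F" "distinct js" "\<And>j. \<alpha> j > 0"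
  shows "sep_harmonic (- set js) (deriv_list wirtinger \<alpha> js F)"
  using assms(2)
proof (induction js)
  case Nil
  then show ?case using assms(1) by simp
next
  case (Cons j js)
  obtain k where k: "\<alpha> j = Suc k" using assms(3) gr0_implies_Suc by blast
  have "sep_harmonic (- set js - {j}) ((wirtinger j ^^ Suc k) (deriv_list wirtinger \<alpha> js F))"
    by (rule sep_harmonic_wirtinger_power) (use Cons in auto)
  moreover have "- set js - {j} = - set (j # js)" by auto
  ultimately show ?case by (simp add: k del: funpow.simps)
qed

lemma deriv_list_lincomb:
  assumes F: "sep_harmonic UNIV F" and G: "sep_harmonic UNIV G" and \<alpha>: "\<And>j. \<alpha> j > 0"
    and js: "distinct js" and z: "z \<in> polydisk"
  shows "deriv_list wirtinger \<alpha> js (\<lambda>z. c * F z + d * G z) z =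
     c * deriv_list wirtinger \<alpha> js F z + d * deriv_list wirtinger \<alpha> js G z"
  using js z
proof (induction js arbitrary: z)
  case (Cons j js)
  obtain k where k: "\<alpha> j = Suc k" using \<alpha> gr0_implies_Suc by blast
  have FG: "sep_harmonic (- set js) (deriv_list wirtinger \<alpha> js F)" "sep_harmonic (- set js) (deriv_list wirtinger \<alpha> js G)"
    using Cons.prems by (auto intro!: sep_harmonic_deriv_list F G \<alpha>)
  have "(wirtinger j ^^ Suc k) (deriv_list wirtinger \<alpha> js (\<lambda>z. c * F z + d * G z)) z =
     c * (wirtinger j ^^ Suc k) (deriv_list wirtinger \<alpha> js F) z +
     d * (wirtinger j ^^ Suc k) (deriv_list wirtinger \<alpha> js G) z"
    by (rule wirtinger_power_lincomb[OF FG]) (use Cons in auto)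
  then show ?case by (simp add: k del: funpow.simps)
qed simp

lemma deriv_list_cnj:
  assumes F: "sep_harmonic UNIV F" and \<alpha>: "\<And>j. \<alpha> j > 0" and js: "distinct js" and z: "z \<in> polydisk"
  shows "deriv_list wirtinger_bar \<alpha> js F z = cnj (deriv_list wirtinger \<alpha> js (\<lambda>z. cnj (F z)) z)"
  using js z
proof (induction js arbitrary: z)
  case (Cons j js)
  obtain k where k: "\<alpha> j = Suc k" using \<alpha> gr0_implies_Suc by blast
  have G: "sep_harmonic (- set js) (deriv_list wirtinger \<alpha> js (\<lambda>z. cnj (F z)))"
    using Cons.prems by (auto intro!: sep_harmonic_deriv_list sep_harmonic_cnj F \<alpha>)
  have "(wirtinger_bar j ^^ Suc k) (deriv_list wirtinger_bar \<alpha> js F) z =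
     cnj ((wirtinger j ^^ Suc k) (deriv_list wirtinger \<alpha> js (\<lambda>z. cnj (F z))) z)"
    by (rule wirtinger_bar_power_cnj[OF G]) (use Cons in auto)
  then show ?case by (simp add: k del: funpow.simps)
qed simp

text \<open>Induction on the list, whose last entry acts first. For that entry the function is still real valued,
and the sharp bound for a real interval gives the factor 2 / pi. Every later block acts on a complex
function; in the variable j of that block it is bounded on the whole slice by the bound already
obtained, which does not depend on the coordinate j, so the bound for a disc applies and costs only
the factor of that variable.\<close>
lemma deriv_list_bound:
  fixes F :: "complex ^ 'n \<Rightarrow> complex"
  assumes F: "sep_harmonic UNIV F" and \<alpha>: "\<And>j. \<alpha> j > 0"
    and FM: "\<And>z. z \<in> polydisk \<Longrightarrow> F z \<in> of_real ` {-M..M}"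
    and js: "distinct js" "js \<noteq> []" and z: "z \<in> polydisk"
  shows "cmod (deriv_list wirtinger \<alpha> js F z) \<le>
     2 * M / pi * (\<Prod>j\<in>set js. schwarz_pick_factor (\<alpha> j) (cmod (z $ j)))"
  using js z
proof (induction js arbitrary: z)
  case (Cons j js)
  obtain k where k: "\<alpha> j = Suc k" using \<alpha> gr0_implies_Suc by blast
  let ?G = "deriv_list wirtinger \<alpha> js F"
  let ?P = "\<Prod>i\<in>set js. schwarz_pick_factor (\<alpha> i) (cmod (z $ i))"
  have G: "sep_harmonic (- set js) ?G" using F Cons.prems \<alpha> by (intro sep_harmonic_deriv_list) auto
  have j: "j \<in> - set js" using Cons.prems by simp
  have "cmod ((wirtinger j ^^ Suc k) ?G z) \<le> 2 * M / pi * ?P * schwarz_pick_factor (Suc k) (cmod (z $ j))"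
  proof (cases "js = []")
    case True
    then show ?thesis
      using wirtinger_power_bound[OF G j coeff_bound_real_interval Cons.prems(3)] FM upd_in_polydisk[OF Cons.prems(3)]
      by simp
  next
    case False
    show ?thesis
    proof (rule wirtinger_power_bound[OF G j coeff_bound_cball Cons.prems(3)])
      fix \<zeta> :: complex assume "\<zeta> \<in> ball 0 1"
      then have "cmod (?G (upd z j \<zeta>)) \<le> 2 * M / pi * (\<Prod>i\<in>set js. schwarz_pick_factor (\<alpha> i) (cmod (upd z j \<zeta> $ i)))"
        using Cons.prems False by (intro Cons.IH upd_in_polydisk) auto
      also have "(\<Prod>i\<in>set js. schwarz_pick_factor (\<alpha> i) (cmod (upd z j \<zeta> $ i))) = ?P"
        using j by (intro prod.cong) auto
      finally show "?G (upd z j \<zeta>) \<in> cball 0 (2 * M / pi * ?P)" by simp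
    qed
  qed
  then show ?case using Cons.prems by (simp add: k mult_ac del: funpow.simps)
qed simp

text \<open>Take c with c^2 = cnj (sgn a) * sgn b; then c * a and cnj c * b have the same argument.\<close>
lemma unimodular_alignment:
  obtains c where "cmod c = 1" "cmod (c * a + cnj c * b) = cmod a + cmod b"
proof (cases "a = 0 \<or> b = 0")
  case True
  then show ?thesis using that[of 1] by auto
next
  case False
  define c where "c = csqrt (cnj (sgn a) * sgn b)"
  have c2: "c ^ 2 = cnj (sgn a) * sgn b" by (simp add: c_def)
  have "cmod (c ^ 2) = 1" unfolding c2 using False by (simp add: norm_mult norm_sgn)
  then have c1: "cmod c = 1" by (simp add: norm_power power2_eq_1_iff) (smt (verit) norm_ge_zero)
  have cc: "cnj c * c = 1" using c1 complex_norm_square[of c] by (simp add: mult.commute)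
  have s: "x = of_real (cmod x) * sgn x" for x :: complex
    by (cases "x = 0") (simp_all add: sgn_div_norm scaleR_conv_of_real)
  have sa: "cnj (sgn a) * sgn a = 1"
    using complex_norm_square[of "sgn a"] False by (simp add: norm_sgn mult.commute)
  have "c * a = cnj c * c ^ 2 * a" using cc by (simp add: power2_eq_square mult.assoc[symmetric])
  also have "\<dots> = cnj c * sgn b * of_real (cmod a) * (cnj (sgn a) * sgn a)"
    unfolding c2 by (subst (2) s) (simp only: mult_ac)
  also have "\<dots> = cnj c * sgn b * of_real (cmod a)" by (simp add: sa)
  finally have "c * a + cnj c * b = cnj c * sgn b * of_real (cmod a + cmod b)"
    using s[of b] by (simp add: algebra_simps)
  then have "cmod (c * a + cnj c * b) = cmod a + cmod b"
    using c1 False by (simp add: norm_mult norm_sgn flip: of_real_add)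
  then show ?thesis using that c1 by blast
qed

lemma schwarz_pick_factor_mono:
  assumes "0 \<le> s" "s \<le> t" "t < 1"
  shows "0 \<le> schwarz_pick_factor a s" "schwarz_pick_factor a s \<le> schwarz_pick_factor a t"
proof -
  have t: "1 - t\<^sup>2 > 0" using assms by (simp add: power_less_one_iff abs_square_less_1)
  have st: "1 - t\<^sup>2 \<le> 1 - s\<^sup>2" using assms by (simp add: power_mono)
  have "1 - s\<^sup>2 > 0" using t st by linarith
  then show "0 \<le> schwarz_pick_factor a s" unfolding schwarz_pick_factor_def using assms
    by (intro mult_nonneg_nonneg divide_nonneg_nonneg zero_le_power) auto
  show "schwarz_pick_factor a s \<le> schwarz_pick_factor a t"
    unfolding schwarz_pick_factor_def using assms t st
    by (intro mult_left_mono frac_le power_mono zero_less_power) auto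
qed

text \<open>Each factor increases with the modulus, so all moduli may be replaced by their maximum; the
exponents \<alpha> j - 1 then add up to |\<alpha>| - n.\<close>
lemma prod_schwarz_pick_factor_le:
  fixes z :: "complex ^ 'n"
  assumes \<alpha>: "\<And>j. \<alpha> j > 0" and z: "z \<in> polydisk"
  shows "(\<Prod>j\<in>UNIV. schwarz_pick_factor (\<alpha> j) (cmod (z $ j))) \<le>
    real (\<Prod>j\<in>UNIV. fact (\<alpha> j)) *
        ((1 + norm_max z) ^ ((\<Sum>j\<in>UNIV. \<alpha> j) - CARD('n)) / (1 - (norm_max z)\<^sup>2) ^ (\<Sum>j\<in>UNIV. \<alpha> j))"
proof -
  have le: "cmod (z $ j) \<le> norm_max z" for j unfolding norm_max_def by (intro Max_ge) auto
  have "norm_max z \<in> range (\<lambda>j. cmod (z $ j))" unfolding norm_max_def by (intro Max_in) auto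
  then have lt: "norm_max z < 1" using polydisk_nth[OF z] by auto
  have "(\<Sum>j\<in>UNIV. \<alpha> j) = (\<Sum>j\<in>UNIV. (\<alpha> j - 1) + 1)" using \<alpha> by (intro sum.cong) auto
  then have sum: "(\<Sum>j\<in>UNIV. \<alpha> j) - CARD('n) = (\<Sum>j\<in>UNIV. \<alpha> j - 1)" by (simp only: sum.distrib) simp
  have "(\<Prod>j\<in>UNIV. schwarz_pick_factor (\<alpha> j) (cmod (z $ j))) \<le> (\<Prod>j\<in>UNIV. schwarz_pick_factor (\<alpha> j) (norm_max z))"
    using schwarz_pick_factor_mono[OF _ le lt] by (intro prod_mono) auto
  also have "\<dots> = real (\<Prod>j\<in>UNIV. fact (\<alpha> j)) *
        ((1 + norm_max z) ^ ((\<Sum>j\<in>UNIV. \<alpha> j) - CARD('n)) / (1 - (norm_max z)\<^sup>2) ^ (\<Sum>j\<in>UNIV. \<alpha> j))"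
    unfolding sum power_sum by (simp add: schwarz_pick_factor_def prod.distrib prod_dividef)
  finally show ?thesis .
qed

theorem theorem1:
  fixes f :: "complex ^ 'n::{finite,linorder} \<Rightarrow> complex"
    and \<alpha> :: "'n::{finite,linorder} \<Rightarrow> nat"
    and z :: "complex ^ 'n::{finite,linorder}"
  assumes "pluriharmonic_on f polydisk"
    and "f \<in> polydisk \<rightarrow> ball 0 1"
    and "\<And>j. \<alpha> j > 0"
    and "z \<in> polydisk"
  shows "cmod (iter_partial wirtinger \<alpha> f z) + cmod (iter_partial wirtinger_bar \<alpha> f z)
     \<le> real (\<Prod>j\<in>UNIV. fact (\<alpha> j)) * (4 / pi) *
        ((1 + norm_max z) ^ ((\<Sum>j\<in>UNIV. \<alpha> j) - CARD('n)) /
         (1 - (norm_max z)\<^sup>2) ^ (\<Sum>j\<in>UNIV. \<alpha> j))"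
proof -
  define js where "js = sorted_list_of_set (UNIV :: 'n set)"
  have js: "distinct js" "set js = UNIV" "js \<noteq> []" by (auto simp: js_def)
  have f: "sep_harmonic UNIV f" by (rule pluriharmonic_imp_sep_harmonic[OF assms(1)])
  define a where "a = deriv_list wirtinger \<alpha> js f z"
  define b where "b = deriv_list wirtinger \<alpha> js (\<lambda>z. cnj (f z)) z"
  obtain c where c: "cmod c = 1" "cmod (c * a + cnj c * b) = cmod a + cmod b"
    by (rule unimodular_alignment)
  \<comment> \<open>this is 2 Re (c f), a real function with values in [-2, 2]\<close>
  define u where "u z = c * f z + cnj c * cnj (f z)" for z
  have "cmod (iter_partial wirtinger \<alpha> f z) + cmod (iter_partial wirtinger_bar \<alpha> f z) = cmod a + cmod b"
    using deriv_list_cnj[OF f assms(3) js(1) assms(4)] by (simp add: iter_partial_def a_def b_def js_def)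
  also have "\<dots> = cmod (deriv_list wirtinger \<alpha> js u z)"
    unfolding u_def deriv_list_lincomb[OF f sep_harmonic_cnj[OF f] assms(3) js(1) assms(4)]
    by (simp add: c(2) a_def[symmetric] b_def[symmetric])
  also have "\<dots> \<le> 2 * 2 / pi * (\<Prod>j\<in>set js. schwarz_pick_factor (\<alpha> j) (cmod (z $ j)))"
  proof (rule deriv_list_bound[OF _ assms(3) _ js(1,3) assms(4)])
    show "sep_harmonic UNIV u" unfolding u_def by (rule sep_harmonic_lincomb[OF f f])
    fix w :: "complex ^ 'n::{finite,linorder}" assume "w \<in> polydisk"
    then have "cmod (f w) < 1" using assms(2) by auto
    then have "cmod (c * f w) < 1" by (simp add: norm_mult c)
    then have "\<bar>Re (c * f w)\<bar> \<le> 1" using abs_Re_le_cmod[of "c * f w"] by linarith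
    then have "2 * Re (c * f w) \<in> {-2..2}" unfolding abs_le_iff by (simp only: atLeastAtMost_iff) linarith
    moreover have "u w = of_real (2 * Re (c * f w))" by (simp add: u_def complex_eq_iff)
    ultimately show "u w \<in> of_real ` {-2..2}" by (rule image_eqI[rotated])
  qed
  also have "\<dots> \<le> 4 / pi * (real (\<Prod>j\<in>UNIV. fact (\<alpha> j)) *
        ((1 + norm_max z) ^ ((\<Sum>j\<in>UNIV. \<alpha> j) - CARD('n)) / (1 - (norm_max z)\<^sup>2) ^ (\<Sum>j\<in>UNIV. \<alpha> j)))"
    unfolding js(2)
    using mult_left_mono[OF prod_schwarz_pick_factor_le[of \<alpha> z, OF assms(3,4)], of "4 / pi"] by simp
  finally show ?thesis by (simp only: mult_ac)
qed

end
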